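(* Let $X$ be a Radon plane, let $\gamma:[0,L]\to S_X$ be the continuous Minkowski arc-length parametrization of its unit circle, and for each $s$ let $r(s)$ be the parameter, unique up to replacing $\gamma(r(s))$ by its antipode, such that $\gamma(s)\perp_B\gamma(r(s))$. If $\mathrm{DR}_B(X)=1$, then for every $s$ and every $t>0$, $$\|t\gamma(s)-t^{-1}\gamma(r(s))\|\ge\|\gamma(s)-\gamma(r(s))\|.$$ If the map $s\mapsto r(s)$ is $C^1$, this condition forces the affine curvature of $S_X$ to be constant; hence $X$ is Euclidean (its norm is induced by an inner product).
   Context: A Radon plane is a two-dimensional real normed space in which Birkhoff orthogonality is symmetric, where $x\perp_B y$ iff $\|x+\lambda y\|\ge\|x\|$ for all $\lambda\in\mathbb R$. $S_X$ is the unit circle, $L$ is its length measured in the norm of $X$, and $\gamma$ traverses $S_X$ once. The existence and uniqueness (up to antipodes) of $r(s)$ for every $s$ is part of the setup. For nonzero $x,y\in X$ put $\alpha[x,y]=\left\|\frac{x}{\|x\|}-\frac{y}{\|y\|}\right\|$ and $\beta[x,y]=\left\|\frac{x}{\|y\|}-\frac{y}{\|x\|}\right\|$, and $$\mathrm{DR}_B(X)=\sup\left\{\frac{\alpha[x,y]}{\beta[x,y]}: x,y\in X\setminus\{0\},\ x\perp_B y,\ \beta[x,y]\ne 0\right\}.$$ *)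

theory Defs
  imports "HOL-Analysis.Analysis"
begin

definition birkhoff_orth :: "'a::real_normed_vector \<Rightarrow> 'a \<Rightarrow> bool" (infix "\<bottom>\<^sub>B" 50) where
  "x \<bottom>\<^sub>B y \<longleftrightarrow> (\<forall>l::real. norm (x + l *\<^sub>R y) \<ge> norm x)"

definition radon_plane :: "'a::real_normed_vector itself \<Rightarrow> bool" where
  "radon_plane _ \<longleftrightarrow> dim (UNIV :: 'a set) = 2 \<and> (\<forall>x y :: 'a. x \<bottom>\<^sub>B y \<longrightarrow> y \<bottom>\<^sub>B x)"

definition norm_from_inner_product :: "'a::real_normed_vector itself \<Rightarrow> bool" where
  "norm_from_inner_product _ \<longleftrightarrow>
     (\<exists>B :: 'a \<Rightarrow> 'a \<Rightarrow> real. bilinear B \<and> (\<forall>x y. B x y = B y x) \<and>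
        (\<forall>x. x \<noteq> 0 \<longrightarrow> B x x > 0) \<and> (\<forall>x. norm x = sqrt (B x x)))"

definition alpha_dist :: "'a::real_normed_vector \<Rightarrow> 'a \<Rightarrow> real" where
  "alpha_dist x y = norm (x /\<^sub>R norm x - y /\<^sub>R norm y)"

definition beta_dist :: "'a::real_normed_vector \<Rightarrow> 'a \<Rightarrow> real" where
  "beta_dist x y = norm (x /\<^sub>R norm y - y /\<^sub>R norm x)"

text \<open>
  The real supremum below is a genuine one as soon as two nonzero Birkhoff orthogonal vectors
  exist: with \<open>t = norm x / norm y\<close>, orthogonality gives
  \<open>beta_dist x y \<ge> max t (1/t - t) \<ge> 1 / sqrt 2\<close>, whereas \<open>alpha_dist x y \<le> 2\<close>.
\<close>

definition DR_B :: "'a::real_normed_vector itself \<Rightarrow> real" where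
  "DR_B _ = Sup {alpha_dist x y / beta_dist x y | x y :: 'a.
                   x \<noteq> 0 \<and> y \<noteq> 0 \<and> x \<bottom>\<^sub>B y \<and> beta_dist x y \<noteq> 0}"

text \<open>
  Length of a curve on \<open>{a..b}\<close> in the norm of the space: the supremum of the lengths of the
  inscribed polygons.
\<close>

definition curve_length :: "(real \<Rightarrow> 'a::real_normed_vector) \<Rightarrow> real \<Rightarrow> real \<Rightarrow> ereal" where
  "curve_length c a b =
     Sup {ereal (\<Sum>i<n. norm (c (p (Suc i)) - c (p i))) | (p :: nat \<Rightarrow> real) n.
            mono_on {..n} p \<and> p 0 = a \<and> p n = b}"

text \<open>
  Arc-length parametrization of the unit circle, traversed once on \<open>{0..L}\<close> and continued
  \<open>L\<close>-periodically to the real line, so that parameters can be read modulo \<open>L\<close>.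
  The case \<open>a = 0\<close>, \<open>b = L\<close> of the length condition makes \<open>L\<close> the length of the unit circle.
\<close>

definition unit_circle_arclength_param ::
    "real \<Rightarrow> (real \<Rightarrow> 'a::real_normed_vector) \<Rightarrow> bool" where
  "unit_circle_arclength_param L g \<longleftrightarrow>
     0 < L \<and> continuous_on {0..L} g \<and> g ` {0..L} = sphere 0 1 \<and> inj_on g {0..<L} \<and>
     (\<forall>s. g (s + L) = g s) \<and>
     (\<forall>a b. 0 \<le> a \<and> a \<le> b \<and> b \<le> L \<longrightarrow> curve_length g a b = ereal (b - a))"

text \<open>
  \<open>r s\<close> is a parameter modulo \<open>L\<close>, hence an arbitrary real number: a continuous choice of it cannot
  stay inside \<open>{0..L}\<close> when \<open>s\<close> runs once around the circle.
\<close>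

definition birkhoff_param ::
    "real \<Rightarrow> (real \<Rightarrow> 'a::real_normed_vector) \<Rightarrow> (real \<Rightarrow> real) \<Rightarrow> bool" where
  "birkhoff_param L g r \<longleftrightarrow>
     (\<forall>s\<in>{0..L}. g s \<bottom>\<^sub>B g (r s) \<and>
        (\<forall>q. g s \<bottom>\<^sub>B g q \<longrightarrow> g q = g (r s) \<or> g q = - g (r s)))"

text \<open>Unlike \<open>C1_differentiable_on\<close>, this uses one-sided derivatives at the endpoints.\<close>

definition C1_on_interval :: "real \<Rightarrow> (real \<Rightarrow> real) \<Rightarrow> bool" where
  "C1_on_interval L r \<longleftrightarrow>
     (\<exists>r'. continuous_on {0..L} r' \<and>
           (\<forall>s\<in>{0..L}. (r has_real_derivative r' s) (at s within {0..L})))"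

definition area_form :: "('a::real_vector \<Rightarrow> 'a \<Rightarrow> real) \<Rightarrow> bool" where
  "area_form w \<longleftrightarrow> bilinear w \<and> (\<forall>x. w x x = 0) \<and> (\<exists>x y. w x y \<noteq> 0)"

definition nth_deriv :: "nat \<Rightarrow> (real \<Rightarrow> 'a::real_normed_vector) \<Rightarrow> real \<Rightarrow> 'a" where
  "nth_deriv n = ((\<lambda>c s. vector_derivative c (at s)) ^^ n)"

text \<open>
  Equi-affine differential geometry of plane curves: a \<open>C\<^sup>3\<close> curve \<open>c\<close> is parametrized by affine
  arc length if \<open>w c' c'' = 1\<close>; then \<open>c''' = - k c'\<close> with the affine curvature \<open>k = w c'' c'''\<close>.
  A closed curve is parametrized periodically over the whole real line.
\<close>

definition affine_arclength_param ::
    "('a::real_normed_vector \<Rightarrow> 'a \<Rightarrow> real) \<Rightarrow> 'a set \<Rightarrow> (real \<Rightarrow> 'a) \<Rightarrow> bool" where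
  "affine_arclength_param w S c \<longleftrightarrow>
     (\<forall>k<3. \<forall>s. nth_deriv k c differentiable at s) \<and> continuous_on UNIV (nth_deriv 3 c) \<and>
     (\<forall>s. w (nth_deriv 1 c s) (nth_deriv 2 c s) = 1) \<and> range c = S"

definition affine_curvature ::
    "('a::real_normed_vector \<Rightarrow> 'a \<Rightarrow> real) \<Rightarrow> (real \<Rightarrow> 'a) \<Rightarrow> real \<Rightarrow> real" where
  "affine_curvature w c s = w (nth_deriv 2 c s) (nth_deriv 3 c s)"

text \<open>
  Rescaling the area form rescales the affine curvature, so the constant depends on \<open>w\<close>. The
  existence clause makes the affine curvature well defined on \<open>S\<close>.
\<close>

definition has_constant_affine_curvature :: "'a::real_normed_vector set \<Rightarrow> bool" where
  "has_constant_affine_curvature S \<longleftrightarrow>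
     (\<forall>w. area_form w \<longrightarrow>
        (\<exists>c. affine_arclength_param w S c) \<and>
        (\<exists>k. \<forall>c. affine_arclength_param w S c \<longrightarrow> (\<forall>s. affine_curvature w c s = k)))"

end

(*
  Orient an area form so that J x denotes the unit vector Birkhoff orthogonal to x with positive
  area. Then gamma' = +-J(gamma), and if r is C^1 with derivative kappa then J(gamma)' = -+kappa gamma;
  in particular the area of (x, J x) is the same for all unit vectors x, and the norm is C^1.
  The hyperbola condition is equivalent to its first-order part at t = 1, which says that
  gamma + J(gamma) and gamma - J(gamma) are Birkhoff orthogonal; hence the product of their norms
  tau and rho is 2. The form area(x, dx) / norm(x)^2 is closed, so it has the same integral
  over all the loops cos(theta) gamma + sin(theta) J(gamma). Taking theta = 0, pi/4, -pi/4, pi/2 shows that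
  1, (1 + kappa)/tau^2, (1 + kappa)/rho^2 and kappa have the same integral L. By the inequality
  between the arithmetic and geometric means this forces tau = rho = sqrt 2, whence kappa = 1,
  gamma'' = -gamma, and the unit circle is an ellipse.
*)
theory Submission
  imports Defs
begin

section \<open>Radon planes and arc length\<close>

text \<open>The hypotheses know \<open>\<gamma>\<close> only through lengths of inscribed polygons,
  so at the start neither \<open>\<gamma>\<close> nor the norm has a derivative, and reaching the
  formula for the derivative of \<open>\<gamma>\<close> is the main obstacle. Uniqueness of the
  orthogonal direction and compactness of the circle make \<open>J\<close> continuous; hence short
  chords are nearly parallel to \<open>J (\<gamma> s)\<close>, and arc length agrees with tangential
  displacement up to a factor close to 1. Radon symmetry gives \<open>J (J x) = - x\<close> on unit
  vectors, which is why the derivatives of \<open>\<gamma>\<close> and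
  \<open>J \<circ> \<gamma>\<close> form a closed linear system. Only first derivatives of the norm
  ever occur: closedness is used as an explicit identity between a derivative in the angle and one
  in the parameter, so neither homotopies nor a second derivative of the norm are required. The
  angles of 45 degrees are chosen because the loops there are multiples of the very vectors that the
  hyperbola condition constrains. The two conclusions are reached in the order opposite to the
  informal statement: the norm is first shown to be Euclidean, and the constant affine curvature is
  then read off the resulting circle.\<close>

lemma birkhoff_orth_scaleR:
  fixes x y :: "'a::real_normed_vector"
  assumes "x \<bottom>\<^sub>B y"
  shows "(a *\<^sub>R x) \<bottom>\<^sub>B (b *\<^sub>R y)"
proof (cases "a = 0")
  case True
  then show ?thesis by (simp add: birkhoff_orth_def)
next
  case False
  have "norm (a *\<^sub>R x) \<le> norm (a *\<^sub>R x + l *\<^sub>R b *\<^sub>R y)" for l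
  proof -
    have "a *\<^sub>R x + l *\<^sub>R b *\<^sub>R y = a *\<^sub>R (x + (l * b / a) *\<^sub>R y)"
      using False by (simp add: scaleR_add_right)
    moreover have "norm x \<le> norm (x + (l * b / a) *\<^sub>R y)"
      using assms by (simp add: birkhoff_orth_def)
    ultimately show ?thesis
      by (simp add: mult_left_mono)
  qed
  then show ?thesis by (simp add: birkhoff_orth_def)
qed

lemma birkhoff_orth_bound:
  fixes x y :: "'a::real_normed_vector"
  assumes "x \<bottom>\<^sub>B y"
  shows "\<bar>a\<bar> * norm x \<le> norm (a *\<^sub>R x + b *\<^sub>R y)"
  using birkhoff_orth_scaleR[OF assms, of a 1] by (simp add: birkhoff_orth_def)

text \<open>For each fixed scalar the inequality is closed in the pair, so the set is an
  intersection of closed sets. This feeds the compactness argument for \<open>J\<close>.\<close>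

lemma closed_birkhoff_orth:
  "closed {p :: 'a::real_normed_vector \<times> 'a. fst p \<bottom>\<^sub>B snd p}"
  unfolding birkhoff_orth_def Collect_all_eq
  by (intro closed_INT ballI closed_Collect_le continuous_intros)

locale radon_circle =
  fixes \<gamma> :: "real \<Rightarrow> 'a::real_normed_vector"
    and r :: "real \<Rightarrow> real"
    and L :: real
  assumes radon: "radon_plane TYPE('a)"
    and arclength: "unit_circle_arclength_param L \<gamma>"
    and birkhoff: "birkhoff_param L \<gamma> r"
begin

lemma L_pos: "0 < L"
  using arclength by (simp add: unit_circle_arclength_param_def)

lemma orth_sym: "(x :: 'a) \<bottom>\<^sub>B y \<Longrightarrow> y \<bottom>\<^sub>B x"
  using radon by (auto simp: radon_plane_def)

lemma \<gamma>_periodic_nat: "\<gamma> (s + real n * L) = \<gamma> s"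
proof (induction n)
  case (Suc n)
  have "\<gamma> (s + real (Suc n) * L) = \<gamma> ((s + real n * L) + L)"
    by (simp add: algebra_simps)
  then show ?case
    using arclength Suc by (simp add: unit_circle_arclength_param_def)
qed simp

lemma \<gamma>_periodic: "\<gamma> (s + of_int k * L) = \<gamma> s"
proof (cases "k \<ge> 0")
  case True
  then show ?thesis using \<gamma>_periodic_nat[of s "nat k"] by simp
next
  case False
  then show ?thesis using \<gamma>_periodic_nat[of "s + of_int k * L" "nat (- k)"] by simp
qed

lemma reduce_mod_L:
  obtains k :: int and u where "s = u + of_int k * L" "0 \<le> u" "u < L"
proof
  show "s = (s - of_int \<lfloor>s / L\<rfloor> * L) + of_int \<lfloor>s / L\<rfloor> * L" by simp
  show "0 \<le> s - of_int \<lfloor>s / L\<rfloor> * L"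
    using L_pos by (metis diff_ge_0_iff_ge floor_divide_lower)
  show "s - of_int \<lfloor>s / L\<rfloor> * L < L"
    using floor_divide_upper[OF L_pos, of s] by (simp add: algebra_simps)
qed

lemma norm_\<gamma> [simp]: "norm (\<gamma> s) = 1"
proof -
  obtain k u where u: "s = u + of_int k * L" "0 \<le> u" "u < L" by (rule reduce_mod_L)
  have "\<gamma> u \<in> \<gamma> ` {0..L}" using u by auto
  moreover have "\<gamma> ` {0..L} = sphere 0 1"
    using arclength by (simp add: unit_circle_arclength_param_def)
  ultimately show ?thesis using u \<gamma>_periodic by auto
qed

lemma \<gamma>_nonzero [simp]: "\<gamma> s \<noteq> 0"
  by (metis norm_\<gamma> norm_zero zero_neq_one)

lemma \<gamma>_surj:
  assumes "norm x = 1"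
  obtains s where "s \<in> {0..L}" "\<gamma> s = x"
  using assms arclength unfolding unit_circle_arclength_param_def
  by (metis (no_types, lifting) image_iff mem_sphere_0)

text \<open>Injectivity on \<open>{0..<L}\<close> does not cover intervals around a multiple of
  \<open>L\<close>. Parameters with the same image reduce to the same value, hence differ by an
  integer multiple of \<open>L\<close>, and only the multiple 0 is shorter than a period.\<close>

lemma \<gamma>_inj:
  assumes "\<gamma> s = \<gamma> t" "\<bar>s - t\<bar> < L"
  shows "s = t"
proof -
  obtain k u where u: "s = u + of_int k * L" "0 \<le> u" "u < L" by (rule reduce_mod_L)
  obtain l v where v: "t = v + of_int l * L" "0 \<le> v" "v < L" by (rule reduce_mod_L)
  have "\<gamma> u = \<gamma> v" using assms(1) u(1) v(1) by (simp add: \<gamma>_periodic)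
  moreover have "inj_on \<gamma> {0..<L}"
    using arclength by (simp add: unit_circle_arclength_param_def)
  ultimately have "u = v" using u v by (auto dest: inj_onD)
  then have "s - t = of_int (k - l) * L" using u v by (simp add: algebra_simps)
  then have "\<bar>of_int (k - l)\<bar> * L < 1 * L" using assms(2) L_pos by (simp add: abs_mult)
  then have "\<bar>of_int (k - l) :: real\<bar> < 1" using L_pos by (subst (asm) mult_less_cancel_right) auto
  then have "k - l = 0" by linarith
  then show ?thesis using \<open>s - t = _\<close> by simp
qed

lemma orth_unique:
  assumes "norm (x :: 'a) = 1" "norm y = 1" "norm z = 1" "x \<bottom>\<^sub>B y" "x \<bottom>\<^sub>B z"
  shows "z = y \<or> z = - y"
proof -
  obtain s where s: "s \<in> {0..L}" "\<gamma> s = x" using \<gamma>_surj assms(1) by blast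
  obtain p where p: "\<gamma> p = y" using \<gamma>_surj assms(2) by blast
  obtain q where q: "\<gamma> q = z" using \<gamma>_surj assms(3) by blast
  have *: "\<And>q. x \<bottom>\<^sub>B \<gamma> q \<Longrightarrow> \<gamma> q = \<gamma> (r s) \<or> \<gamma> q = - \<gamma> (r s)"
    using birkhoff s unfolding birkhoff_param_def by blast
  show ?thesis using *[of p] *[of q] assms p q by auto
qed

lemma orth_exists:
  assumes "norm (x :: 'a) = 1"
  obtains y where "norm y = 1" "x \<bottom>\<^sub>B y"
proof -
  obtain s where s: "s \<in> {0..L}" "\<gamma> s = x" using \<gamma>_surj assms(1) by blast
  show ?thesis using that[of "\<gamma> (r s)"] s birkhoff unfolding birkhoff_param_def by auto
qed

section \<open>Coordinates and an area form from one orthogonal pair\<close>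

definition e\<^sub>1 :: 'a where "e\<^sub>1 = \<gamma> 0"
definition e\<^sub>2 :: 'a where "e\<^sub>2 = \<gamma> (r 0)"

lemma e_orth: "e\<^sub>1 \<bottom>\<^sub>B e\<^sub>2" "e\<^sub>2 \<bottom>\<^sub>B e\<^sub>1"
proof -
  show "e\<^sub>1 \<bottom>\<^sub>B e\<^sub>2"
    using birkhoff L_pos unfolding birkhoff_param_def e\<^sub>1_def e\<^sub>2_def by auto
  then show "e\<^sub>2 \<bottom>\<^sub>B e\<^sub>1" by (rule orth_sym)
qed

lemma norm_e [simp]: "norm e\<^sub>1 = 1" "norm e\<^sub>2 = 1"
  by (simp_all add: e\<^sub>1_def e\<^sub>2_def)

text \<open>Orthogonality in both directions bounds both coordinates, which yields linear
  independence and bounded coordinate functionals at once.\<close>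

lemma e_bounds:
  "\<bar>a\<bar> \<le> norm (a *\<^sub>R e\<^sub>1 + b *\<^sub>R e\<^sub>2)" "\<bar>b\<bar> \<le> norm (a *\<^sub>R e\<^sub>1 + b *\<^sub>R e\<^sub>2)"
  using birkhoff_orth_bound[OF e_orth(1), of a b] birkhoff_orth_bound[OF e_orth(2), of b a]
  by (simp_all add: add.commute)

lemma e_unique:
  assumes "a *\<^sub>R e\<^sub>1 + b *\<^sub>R e\<^sub>2 = c *\<^sub>R e\<^sub>1 + d *\<^sub>R e\<^sub>2"
  shows "a = c" "b = d"
proof -
  have "(a - c) *\<^sub>R e\<^sub>1 + (b - d) *\<^sub>R e\<^sub>2 = 0" using assms by (simp add: algebra_simps)
  then have "\<bar>a - c\<bar> \<le> 0" "\<bar>b - d\<bar> \<le> 0" using e_bounds[where a = "a - c" and b = "b - d"] by (metis norm_zero)+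
  then show "a = c" "b = d" by (simp_all only: abs_le_zero_iff eq_iff_diff_eq_0[symmetric])
qed

lemma e_span: "\<exists>a b. x = a *\<^sub>R e\<^sub>1 + b *\<^sub>R e\<^sub>2"
proof -
  have ne: "e\<^sub>1 \<noteq> e\<^sub>2" using e_unique[of 1 0 0 1] by auto
  have ind: "independent {e\<^sub>1, e\<^sub>2}"
  proof (rule real_vector.independent_if_scalars_zero)
    fix f x assume s: "(\<Sum>x\<in>{e\<^sub>1, e\<^sub>2}. f x *\<^sub>R x) = 0" and x: "x \<in> {e\<^sub>1, e\<^sub>2}"
    have "f e\<^sub>1 *\<^sub>R e\<^sub>1 + f e\<^sub>2 *\<^sub>R e\<^sub>2 = 0 *\<^sub>R e\<^sub>1 + 0 *\<^sub>R e\<^sub>2" using s ne by simp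
    then show "f x = 0" using e_unique x by blast
  qed simp
  have dim: "dim (UNIV :: 'a set) = 2" using radon by (simp add: radon_plane_def)
  obtain B :: "'a set" where B: "independent B" "UNIV \<subseteq> span B" "card B = dim (UNIV :: 'a set)"
    by (rule real_vector.basis_exists[of UNIV])
  \<comment> \<open>An infinite set has \<open>card\<close> 0, so cardinality 2 forces
    finiteness.\<close>
  have finB: "finite B" using B dim card.infinite by fastforce
  have "x \<in> span {e\<^sub>1, e\<^sub>2}"
  proof (rule ccontr)
    assume x: "x \<notin> span {e\<^sub>1, e\<^sub>2}"
    have "independent (insert x {e\<^sub>1, e\<^sub>2})" by (rule real_vector.independent_insertI[OF x ind])
    then have "card (insert x {e\<^sub>1, e\<^sub>2}) \<le> card B"
      using real_vector.independent_span_bound[OF finB] B(2) by blast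
    moreover have "x \<notin> {e\<^sub>1, e\<^sub>2}" using x real_vector.span_base[of x "{e\<^sub>1, e\<^sub>2}"] by blast
    ultimately show False using ne B dim by simp
  qed
  then obtain k where "x - k *\<^sub>R e\<^sub>1 \<in> span {e\<^sub>2}" using real_vector.span_breakdown_eq by blast
  then obtain l where "x - k *\<^sub>R e\<^sub>1 = l *\<^sub>R e\<^sub>2" by (auto simp: real_vector.span_singleton)
  then have "x = k *\<^sub>R e\<^sub>1 + l *\<^sub>R e\<^sub>2" by (simp add: algebra_simps)
  then show ?thesis by blast
qed

definition co\<^sub>1 :: "'a \<Rightarrow> real" where "co\<^sub>1 x = (THE a. \<exists>b. x = a *\<^sub>R e\<^sub>1 + b *\<^sub>R e\<^sub>2)"
definition co\<^sub>2 :: "'a \<Rightarrow> real" where "co\<^sub>2 x = (THE b. \<exists>a. x = a *\<^sub>R e\<^sub>1 + b *\<^sub>R e\<^sub>2)"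

lemma co_combination [simp]:
  "co\<^sub>1 (a *\<^sub>R e\<^sub>1 + b *\<^sub>R e\<^sub>2) = a" "co\<^sub>2 (a *\<^sub>R e\<^sub>1 + b *\<^sub>R e\<^sub>2) = b"
  unfolding co\<^sub>1_def co\<^sub>2_def by (rule the_equality; use e_unique in blast)+

lemma co_expand: "x = co\<^sub>1 x *\<^sub>R e\<^sub>1 + co\<^sub>2 x *\<^sub>R e\<^sub>2"
  using e_span[of x] by auto

lemma co_eqI: "co\<^sub>1 x = co\<^sub>1 y \<Longrightarrow> co\<^sub>2 x = co\<^sub>2 y \<Longrightarrow> x = y"
  using co_expand[of x] co_expand[of y] by simp

lemma co_add [simp]: "co\<^sub>1 (x + y) = co\<^sub>1 x + co\<^sub>1 y" "co\<^sub>2 (x + y) = co\<^sub>2 x + co\<^sub>2 y"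
proof -
  have "x + y = (co\<^sub>1 x + co\<^sub>1 y) *\<^sub>R e\<^sub>1 + (co\<^sub>2 x + co\<^sub>2 y) *\<^sub>R e\<^sub>2"
    by (subst co_expand[of x], subst co_expand[of y]) (simp add: algebra_simps)
  then show "co\<^sub>1 (x + y) = co\<^sub>1 x + co\<^sub>1 y" "co\<^sub>2 (x + y) = co\<^sub>2 x + co\<^sub>2 y"
    by (metis co_combination)+
qed

lemma co_scaleR [simp]: "co\<^sub>1 (c *\<^sub>R x) = c * co\<^sub>1 x" "co\<^sub>2 (c *\<^sub>R x) = c * co\<^sub>2 x"
proof -
  have "c *\<^sub>R x = (c * co\<^sub>1 x) *\<^sub>R e\<^sub>1 + (c * co\<^sub>2 x) *\<^sub>R e\<^sub>2"
    by (subst co_expand[of x]) (simp add: algebra_simps)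
  then show "co\<^sub>1 (c *\<^sub>R x) = c * co\<^sub>1 x" "co\<^sub>2 (c *\<^sub>R x) = c * co\<^sub>2 x"
    by (metis co_combination)+
qed

lemma co_bounds: "\<bar>co\<^sub>1 x\<bar> \<le> norm x" "\<bar>co\<^sub>2 x\<bar> \<le> norm x"
  using e_bounds[where a = "co\<^sub>1 x" and b = "co\<^sub>2 x"] co_expand[of x] by metis+

lemma bounded_linear_co: "bounded_linear co\<^sub>1" "bounded_linear co\<^sub>2"
  using co_bounds by (auto intro!: bounded_linear_intro[where K = 1])

lemma co_diff [simp]: "co\<^sub>1 (x - y) = co\<^sub>1 x - co\<^sub>1 y" "co\<^sub>2 (x - y) = co\<^sub>2 x - co\<^sub>2 y"
  using bounded_linear_co[THEN bounded_linear.linear] by (simp_all add: linear_diff)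

definition \<omega> :: "'a \<Rightarrow> 'a \<Rightarrow> real" where
  "\<omega> x y = co\<^sub>1 x * co\<^sub>2 y - co\<^sub>2 x * co\<^sub>1 y"

lemma bounded_bilinear_\<omega>: "bounded_bilinear \<omega>"
proof
  show "\<exists>K. \<forall>a b. norm (\<omega> a b) \<le> norm a * norm b * K"
  proof (intro exI allI)
    fix a b :: 'a
    have "\<bar>co\<^sub>1 a * co\<^sub>2 b\<bar> \<le> norm a * norm b" "\<bar>co\<^sub>2 a * co\<^sub>1 b\<bar> \<le> norm a * norm b"
      unfolding abs_mult by (intro mult_mono co_bounds norm_ge_zero abs_ge_zero)+
    then show "norm (\<omega> a b) \<le> norm a * norm b * 2" by (simp add: \<omega>_def)
  qed
qed (simp_all add: \<omega>_def algebra_simps)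

lemmas \<omega>_linear = bounded_bilinear.add_left[OF bounded_bilinear_\<omega>]
  bounded_bilinear.add_right[OF bounded_bilinear_\<omega>]
  bounded_bilinear.diff_left[OF bounded_bilinear_\<omega>]
  bounded_bilinear.diff_right[OF bounded_bilinear_\<omega>]
  bounded_bilinear.minus_left[OF bounded_bilinear_\<omega>]
  bounded_bilinear.minus_right[OF bounded_bilinear_\<omega>]
  bounded_bilinear.scaleR_left[OF bounded_bilinear_\<omega>]
  bounded_bilinear.scaleR_right[OF bounded_bilinear_\<omega>]
  bounded_bilinear.zero_left[OF bounded_bilinear_\<omega>]
  bounded_bilinear.zero_right[OF bounded_bilinear_\<omega>]

lemmas continuous_on_\<omega> [continuous_intros] =
  bounded_bilinear.continuous_on[OF bounded_bilinear_\<omega>]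
lemmas tendsto_\<omega> [tendsto_intros] = bounded_bilinear.tendsto[OF bounded_bilinear_\<omega>]

lemma \<omega>_self [simp]: "\<omega> x x = 0"
  by (simp add: \<omega>_def)

lemma \<omega>_commute: "\<omega> y x = - \<omega> x y"
  by (simp add: \<omega>_def)

lemma cramer: "\<omega> x y *\<^sub>R p = \<omega> p y *\<^sub>R x + \<omega> x p *\<^sub>R y"
  by (rule co_eqI) (simp_all add: \<omega>_def, simp_all add: algebra_simps)

lemma cramer_div:
  "\<omega> x y \<noteq> 0 \<Longrightarrow> p = (\<omega> p y / \<omega> x y) *\<^sub>R x + (\<omega> x p / \<omega> x y) *\<^sub>R y"
  using arg_cong[OF cramer[of x y p], of "\<lambda>v. v /\<^sub>R \<omega> x y"]
  by (simp add: scaleR_add_right divide_inverse mult.commute)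

text \<open>If the area vanished, Cramer's identity would be a linear relation between
  \<open>x\<close> and \<open>y\<close> for every \<open>p\<close>, and orthogonality would kill its
  coefficient \<open>\<omega> p y\<close>; testing with the basis vectors gives
  \<open>y = 0\<close>.\<close>

lemma \<omega>_orth_nonzero:
  assumes "x \<noteq> 0" "y \<noteq> 0" "x \<bottom>\<^sub>B y"
  shows "\<omega> x y \<noteq> 0"
proof
  assume 0: "\<omega> x y = 0"
  have pr: "\<omega> p y *\<^sub>R x + \<omega> x p *\<^sub>R y = 0" for p using cramer[of x y p] 0 by simp
  have "\<bar>\<omega> p y\<bar> * norm x \<le> 0" for p
    using birkhoff_orth_bound[OF assms(3), of "\<omega> p y" "\<omega> x p"] pr[of p] by simp
  then have "\<omega> p y = 0" for p using assms(1) by (simp add: mult_le_0_iff)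
  from this[of e\<^sub>1] this[of e\<^sub>2] have "co\<^sub>1 y = 0" "co\<^sub>2 y = 0"
    using co_combination[of 1 0] co_combination[of 0 1] by (simp_all add: \<omega>_def)
  then show False using co_expand[of y] assms(2) by simp
qed

text \<open>The functional pairing with \<open>y\<close> under \<open>\<omega>\<close> attains its
  norm in the direction of \<open>x\<close>: the line through \<open>x\<close> parallel to
  \<open>y\<close> supports the ball of radius \<open>norm x\<close>.\<close>

lemma \<omega>_orth_bound:
  assumes "x \<bottom>\<^sub>B y"
  shows "\<bar>\<omega> p y\<bar> * norm x \<le> \<bar>\<omega> x y\<bar> * norm p"
  using birkhoff_orth_bound[OF assms, of "\<omega> p y" "\<omega> x p"] cramer[of x y p, symmetric] by simp

section \<open>The Birkhoff quarter turn and its continuity\<close>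

definition J :: "'a \<Rightarrow> 'a" where
  "J x = (SOME y. norm y = 1 \<and> x \<bottom>\<^sub>B y \<and> 0 < \<omega> x y)"

text \<open>Either of the two opposite unit vectors orthogonal to \<open>x\<close> can be flipped to
  the positive side. At 0 no vector has positive area, so \<open>J 0\<close> is an unspecified
  default value.\<close>

lemma J_exists:
  assumes "x \<noteq> 0"
  shows "norm (J x) = 1 \<and> x \<bottom>\<^sub>B J x \<and> 0 < \<omega> x (J x)"
proof -
  obtain y where y: "norm y = 1" "(x /\<^sub>R norm x) \<bottom>\<^sub>B y"
    using orth_exists[of "x /\<^sub>R norm x"] assms by auto
  then have xy: "x \<bottom>\<^sub>B y" using birkhoff_orth_scaleR[OF y(2), of "norm x" 1] assms by simp
  have "\<omega> x y \<noteq> 0" using \<omega>_orth_nonzero[OF assms _ xy] y by force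
  moreover have "x \<bottom>\<^sub>B (- y)" using birkhoff_orth_scaleR[OF xy, of 1 "-1"] by simp
  ultimately have "\<exists>y. norm y = 1 \<and> x \<bottom>\<^sub>B y \<and> 0 < \<omega> x y"
    using y xy by (intro exI[of _ "if \<omega> x y > 0 then y else - y"]) (auto simp: \<omega>_linear)
  then show ?thesis unfolding J_def by (rule someI_ex)
qed

lemma norm_J [simp]: "x \<noteq> 0 \<Longrightarrow> norm (J x) = 1"
  and orth_J: "x \<noteq> 0 \<Longrightarrow> x \<bottom>\<^sub>B J x"
  and \<omega>_J_pos: "x \<noteq> 0 \<Longrightarrow> 0 < \<omega> x (J x)"
  using J_exists by auto

lemma J_nonzero [simp]: "x \<noteq> 0 \<Longrightarrow> J x \<noteq> 0"
  by (metis norm_J norm_zero zero_neq_one)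

text \<open>The weak inequality is enough because \<open>- J x\<close> has strictly negative area.
  Being a closed condition, it can be used in the compactness argument below.\<close>

lemma J_eqI:
  assumes "x \<noteq> 0" "norm y = 1" "x \<bottom>\<^sub>B y" "0 \<le> \<omega> x y"
  shows "J x = y"
proof -
  let ?u = "x /\<^sub>R norm x"
  have "?u \<bottom>\<^sub>B y" "?u \<bottom>\<^sub>B J x"
    using birkhoff_orth_scaleR[OF assms(3), of _ 1] birkhoff_orth_scaleR[OF orth_J, of x _ 1] assms
    by auto
  then have "J x = y \<or> J x = - y" using orth_unique[of ?u y "J x"] assms by auto
  moreover have "J x \<noteq> - y" using \<omega>_J_pos[OF assms(1)] assms(4) by (auto simp: \<omega>_linear)
  ultimately show ?thesis by blast
qed

lemma J_scaleR: "0 < c \<Longrightarrow> x \<noteq> 0 \<Longrightarrow> J (c *\<^sub>R x) = J x"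
  using birkhoff_orth_scaleR[OF orth_J, of x c 1] \<omega>_J_pos[of x]
  by (intro J_eqI) (auto simp: \<omega>_linear)

lemma J_minus: "x \<noteq> 0 \<Longrightarrow> J (- x) = - J x"
  using birkhoff_orth_scaleR[OF orth_J, of x "-1" "-1"] \<omega>_J_pos[of x]
  by (intro J_eqI) (auto simp: \<omega>_linear)

text \<open>Radon symmetry makes \<open>x\<close> orthogonal to \<open>J x\<close> from the other
  side as well; antisymmetry of the area selects the sign.\<close>

lemma J_J: "norm x = 1 \<Longrightarrow> J (J x) = - x"
proof -
  assume x: "norm x = 1"
  then have "x \<noteq> 0" by auto
  then show ?thesis
    using birkhoff_orth_scaleR[OF orth_sym[OF orth_J], of x 1 "-1"] \<omega>_J_pos[of x] x
    by (intro J_eqI) (auto simp: \<omega>_linear \<omega>_commute[of x "J x"])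
qed

lemma compact_sphere_0_1: "compact (sphere (0::'a) 1)"
proof -
  have "continuous_on {0..L} \<gamma>" "\<gamma> ` {0..L} = sphere 0 1"
    using arclength by (auto simp: unit_circle_arclength_param_def)
  then show ?thesis using compact_continuous_image compact_Icc by metis
qed

text \<open>A closed-graph argument: the preimage of a closed set is the projection of a compact set
  of orthogonal, nonnegatively oriented unit pairs, and by \<open>J_eqI\<close> these pairs are
  exactly the graph of \<open>J\<close> over the preimage.\<close>

lemma continuous_on_J_sphere: "continuous_on (sphere 0 1) J"
proof -
  have "closed (J -` B \<inter> sphere 0 1)" if B: "closed B" for B
  proof -
    let ?C = "sphere 0 1 \<times> sphere 0 1 \<inter>
      ({p. fst p \<bottom>\<^sub>B snd p} \<inter> {p. 0 \<le> \<omega> (fst p) (snd p)} \<inter> snd -` B)"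
    have "closed ({p. fst p \<bottom>\<^sub>B snd p} \<inter> {p. 0 \<le> \<omega> (fst p) (snd p)} \<inter> snd -` B)"
      by (intro closed_Int closed_birkhoff_orth closed_Collect_le closed_vimage_snd B continuous_intros)
    then have "compact ?C"
      by (intro compact_Int_closed compact_Times compact_sphere_0_1)
    then have "closed (fst ` ?C)"
      by (intro compact_imp_closed compact_continuous_image continuous_intros)
    moreover have "fst ` ?C = J -` B \<inter> sphere 0 1"
    proof
      show "fst ` ?C \<subseteq> J -` B \<inter> sphere 0 1"
      proof (rule image_subsetI)
        fix p assume p: "p \<in> ?C"
        then have "J (fst p) = snd p" by (intro J_eqI) auto
        then show "fst p \<in> J -` B \<inter> sphere 0 1" using p by auto
      qed
      show "J -` B \<inter> sphere 0 1 \<subseteq> fst ` ?C"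
      proof
        fix x assume x: "x \<in> J -` B \<inter> sphere 0 1"
        then have ne: "x \<noteq> 0" by auto
        note norm_J[OF ne] orth_J[OF ne] less_imp_le[OF \<omega>_J_pos[OF ne]]
        then have "(x, J x) \<in> ?C" using x by (simp del: norm_J)
        then show "x \<in> fst ` ?C" by (rule image_eqI[rotated]) simp
      qed
    qed
    ultimately show ?thesis by simp
  qed
  then show ?thesis
    using continuous_on_closed_vimage[OF compact_imp_closed[OF compact_sphere_0_1]] by blast
qed

lemma continuous_on_J: "continuous_on (- {0}) J"
proof -
  have "(\<lambda>x. x /\<^sub>R norm x) ` (- {0}) \<subseteq> sphere (0 :: 'a) 1"
    by clarsimp (metis left_inverse norm_eq_zero)
  then have "continuous_on (- {0}) (\<lambda>x. J (x /\<^sub>R norm x))"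
    by (intro continuous_on_compose2[OF continuous_on_J_sphere] continuous_intros) auto
  then show ?thesis
    by (rule continuous_on_eq) (simp add: J_scaleR)
qed

lemmas continuous_on_J' [continuous_intros] = continuous_on_compose2[OF continuous_on_J]

section \<open>Arc length against chords\<close>

text \<open>The length hypothesis concerns subintervals of \<open>{0..L}\<close> only. Translating
  by whole periods and cutting once at \<open>L\<close> carries a property over to every arc of at
  most one turn.\<close>

lemma arc_cases:
  assumes base: "\<And>a b. 0 \<le> a \<Longrightarrow> a \<le> b \<Longrightarrow> b \<le> L \<Longrightarrow> P a b"
    and shift: "\<And>a b (k::int). P a b \<Longrightarrow> P (a + of_int k * L) (b + of_int k * L)"
    and join: "\<And>a b c. a \<le> b \<Longrightarrow> b \<le> c \<Longrightarrow> P a b \<Longrightarrow> P b c \<Longrightarrow> P a c"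
    and "a \<le> b" "b \<le> a + L"
  shows "P a b"
proof -
  obtain k u where u: "a = u + of_int k * L" "0 \<le> u" "u < L" by (rule reduce_mod_L)
  define v where "v = b - of_int k * L"
  have v: "u \<le> v" "v \<le> u + L" using u assms by (auto simp: v_def)
  have "P u v"
  proof (cases "v \<le> L")
    case True
    then show ?thesis using base u v by auto
  next
    case False
    have "P u L" using base u by auto
    moreover have "P (0 + of_int 1 * L) ((v - L) + of_int 1 * L)"
      by (rule shift, rule base) (use False u v in auto)
    ultimately show ?thesis using join[of u L v] u False by auto
  qed
  then show ?thesis using shift[of u v k] u by (simp add: v_def)
qed

text \<open>A chord is an inscribed polygon with a single edge.\<close>

lemma \<gamma>_chord_le:
  assumes "a \<le> b" "b \<le> a + L"
  shows "norm (\<gamma> b - \<gamma> a) \<le> b - a"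
  using _ _ _ assms
proof (rule arc_cases)
  fix a b :: real assume ab: "0 \<le> a" "a \<le> b" "b \<le> L"
  define p where "p i = (if i = 0 then a else b)" for i :: nat
  have "mono_on {..1} p \<and> p 0 = a \<and> p 1 = b" using ab by (auto simp: p_def mono_on_def)
  then have "ereal (\<Sum>i<1. norm (\<gamma> (p (Suc i)) - \<gamma> (p i))) \<le> curve_length \<gamma> a b"
    unfolding curve_length_def by (intro Sup_upper) blast
  moreover have "curve_length \<gamma> a b = ereal (b - a)"
    using arclength ab by (simp add: unit_circle_arclength_param_def)
  ultimately show "norm (\<gamma> b - \<gamma> a) \<le> b - a" by (simp add: p_def)
next
  fix a b c :: real assume "norm (\<gamma> b - \<gamma> a) \<le> b - a" "norm (\<gamma> c - \<gamma> b) \<le> c - b"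
  moreover have "norm (\<gamma> c - \<gamma> a) \<le> norm (\<gamma> c - \<gamma> b) + norm (\<gamma> b - \<gamma> a)"
    by (rule order_trans[OF _ norm_triangle_ineq]) simp
  ultimately show "norm (\<gamma> c - \<gamma> a) \<le> c - a" by linarith
qed (simp_all add: \<gamma>_periodic)

text \<open>Increments of \<open>h\<close> telescope along every inscribed polygon, hence dominate
  the supremum of the polygon lengths. This replaces integration of the speed while no derivative of
  \<open>\<gamma>\<close> is known.\<close>

lemma arc_le_of_chord_le:
  assumes "a \<le> b" "b \<le> a + L"
    and h: "\<And>u v. a \<le> u \<Longrightarrow> u \<le> v \<Longrightarrow> v \<le> b \<Longrightarrow> norm (\<gamma> v - \<gamma> u) \<le> h v - h u"
  shows "b - a \<le> (h b - h a :: real)"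
proof -
  \<comment> \<open>\<open>h\<close> is quantified inside \<open>P\<close> because translating the
    interval needs the property for a translated \<open>h\<close>.\<close>
  define P where "P a b \<longleftrightarrow> (\<forall>h. (\<forall>u v. a \<le> u \<and> u \<le> v \<and> v \<le> b \<longrightarrow>
    norm (\<gamma> v - \<gamma> u) \<le> h v - h u) \<longrightarrow> b - a \<le> (h b - h a :: real))" for a b
  have "P a b"
    using _ _ _ assms(1,2)
  proof (rule arc_cases)
    fix a b :: real assume ab: "0 \<le> a" "a \<le> b" "b \<le> L"
    show "P a b"
      unfolding P_def
    proof (intro allI impI)
      fix h :: "real \<Rightarrow> real"
      assume h: "\<forall>u v. a \<le> u \<and> u \<le> v \<and> v \<le> b \<longrightarrow> norm (\<gamma> v - \<gamma> u) \<le> h v - h u"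
      have "(\<Sum>i<n. norm (\<gamma> (p (Suc i)) - \<gamma> (p i))) \<le> h b - h a"
        if p: "mono_on {..n} p" "p 0 = a" "p n = b" for p n
      proof -
        have "norm (\<gamma> (p (Suc i)) - \<gamma> (p i)) \<le> h (p (Suc i)) - h (p i)" if i: "i < n" for i
        proof -
          have "p 0 \<le> p i" "p i \<le> p (Suc i)" "p (Suc i) \<le> p n"
            by (rule mono_onD[OF p(1)]; use i in simp)+
          then show ?thesis using h p by auto
        qed
        then have "(\<Sum>i<n. norm (\<gamma> (p (Suc i)) - \<gamma> (p i))) \<le> (\<Sum>i<n. h (p (Suc i)) - h (p i))"
          by (intro sum_mono) auto
        also have "\<dots> = h (p n) - h (p 0)" by (rule sum_lessThan_telescope)
        finally show ?thesis using p by simp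
      qed
      then have "curve_length \<gamma> a b \<le> ereal (h b - h a)"
        unfolding curve_length_def by (intro Sup_least) auto
      moreover have "curve_length \<gamma> a b = ereal (b - a)"
        using arclength ab by (simp add: unit_circle_arclength_param_def)
      ultimately show "b - a \<le> h b - h a" by simp
    qed
  next
    fix a b :: real and k :: int assume *: "P a b"
    show "P (a + of_int k * L) (b + of_int k * L)"
      unfolding P_def
    proof (intro allI impI)
      fix h :: "real \<Rightarrow> real"
      assume h: "\<forall>u v. a + of_int k * L \<le> u \<and> u \<le> v \<and> v \<le> b + of_int k * L \<longrightarrow>
        norm (\<gamma> v - \<gamma> u) \<le> h v - h u"
      have "norm (\<gamma> v - \<gamma> u) \<le> h (v + of_int k * L) - h (u + of_int k * L)"
        if "a \<le> u" "u \<le> v" "v \<le> b" for u v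
        using h[rule_format, of "u + of_int k * L" "v + of_int k * L"] that by (simp add: \<gamma>_periodic)
      then have "b - a \<le> h (b + of_int k * L) - h (a + of_int k * L)"
        using *[unfolded P_def, rule_format, of "\<lambda>u. h (u + of_int k * L)"] by blast
      then show "(b + of_int k * L) - (a + of_int k * L)
        \<le> h (b + of_int k * L) - h (a + of_int k * L)" by simp
    qed
  next
    fix a b c assume *: "a \<le> b" "b \<le> c" "P a b" "P b c"
    show "P a c"
      unfolding P_def
    proof (intro allI impI)
      fix h :: "real \<Rightarrow> real"
      assume h: "\<forall>u v. a \<le> u \<and> u \<le> v \<and> v \<le> c \<longrightarrow> norm (\<gamma> v - \<gamma> u) \<le> h v - h u"
      have "b - a \<le> h b - h a" using *(3)[unfolded P_def, rule_format, of h] h * by auto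
      moreover have "c - b \<le> h c - h b" using *(4)[unfolded P_def, rule_format, of h] h * by auto
      ultimately show "c - a \<le> h c - h a" by linarith
    qed
  qed
  then show ?thesis using h unfolding P_def by blast
qed

lemma isCont_\<gamma>: "isCont \<gamma> s"
  unfolding LIM_def isCont_def
proof (intro allI impI)
  fix e :: real assume e: "0 < e"
  have "dist (\<gamma> u) (\<gamma> s) < e" if "dist u s < min e L" for u
  proof (cases "u \<le> s")
    case True
    then show ?thesis
      using \<gamma>_chord_le[of u s] that by (simp add: dist_norm norm_minus_commute)
  next
    case False
    then show ?thesis
      using \<gamma>_chord_le[of s u] that by (simp add: dist_norm)
  qed
  then show "\<exists>d>0. \<forall>u. u \<noteq> s \<and> dist u s < d \<longrightarrow> dist (\<gamma> u) (\<gamma> s) < e"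
    using e L_pos by (intro exI[of _ "min e L"]) auto
qed

lemma continuous_on_\<gamma>: "continuous_on S \<gamma>"
  by (simp add: continuous_at_imp_continuous_on isCont_\<gamma>)

lemmas continuous_on_\<gamma>' [continuous_intros] =
  continuous_on_compose2[OF continuous_on_\<gamma>[of UNIV], OF _ subset_UNIV]

section \<open>Differentiability of the unit circle\<close>

definition rad :: "real \<Rightarrow> real \<Rightarrow> real" where
  "rad s u = \<omega> (\<gamma> u) (J (\<gamma> s)) / \<omega> (\<gamma> s) (J (\<gamma> s))"
definition tang :: "real \<Rightarrow> real \<Rightarrow> real" where
  "tang s u = \<omega> (\<gamma> s) (\<gamma> u) / \<omega> (\<gamma> s) (J (\<gamma> s))"

lemma \<gamma>_expand: "\<gamma> u = rad s u *\<^sub>R \<gamma> s + tang s u *\<^sub>R J (\<gamma> s)"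
  unfolding rad_def tang_def by (rule cramer_div) (use \<omega>_J_pos[of "\<gamma> s"] in simp)

lemma tang_self [simp]: "tang s s = 0" and rad_self [simp]: "rad s s = 1"
  using \<omega>_J_pos[of "\<gamma> s"] by (simp_all add: tang_def rad_def)

lemma \<gamma>_diff_expand:
  "\<gamma> v - \<gamma> u = (rad s v - rad s u) *\<^sub>R \<gamma> s + (tang s v - tang s u) *\<^sub>R J (\<gamma> s)"
  by (subst \<gamma>_expand[of v s], subst \<gamma>_expand[of u s]) (simp add: algebra_simps)

lemma tang_diff_le: "\<bar>tang s v - tang s u\<bar> \<le> norm (\<gamma> v - \<gamma> u)"
  unfolding \<gamma>_diff_expand[of v u s]
  using birkhoff_orth_bound[OF orth_sym[OF orth_J[of "\<gamma> s"]],
      of "tang s v - tang s u" "rad s v - rad s u"]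
  by (simp add: add.commute)

lemma norm_\<gamma>_diff_le: "norm (\<gamma> v - \<gamma> u) \<le> \<bar>rad s v - rad s u\<bar> + \<bar>tang s v - tang s u\<bar>"
  unfolding \<gamma>_diff_expand[of v u s]
  by (rule order_trans[OF norm_triangle_ineq]) simp

lemma continuous_on_tang: "continuous_on S (tang s)"
  unfolding tang_def by (intro continuous_intros) (use \<omega>_J_pos[of "\<gamma> s"] in auto)

text \<open>The supporting lines at both ends of a short chord force it to be almost tangential.\<close>

lemma chord_almost_tangential:
  assumes e: "0 < e"
  obtains d where "0 < d"
    "\<And>u v. \<bar>u - s\<bar> < d \<Longrightarrow> \<bar>v - s\<bar> < d \<Longrightarrow>
      \<bar>rad s v - rad s u\<bar> \<le> e * \<bar>tang s v - tang s u\<bar>"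
proof -
  let ?x = "\<gamma> s" and ?y = "J (\<gamma> s)"
  define A where "A = \<omega> ?x ?y"
  have A: "0 < A" by (simp add: A_def \<omega>_J_pos)
  have "continuous_on UNIV (\<lambda>u. \<omega> ?x (J (\<gamma> u)))" "continuous_on UNIV (\<lambda>u. \<omega> ?y (J (\<gamma> u)))"
    by (intro continuous_intros; auto)+
  then have "isCont (\<lambda>u. \<omega> ?x (J (\<gamma> u))) s" "isCont (\<lambda>u. \<omega> ?y (J (\<gamma> u))) s"
    by (simp_all add: continuous_on_eq_continuous_at)
  then have lim: "(\<lambda>u. \<omega> ?x (J (\<gamma> u))) \<midarrow>s\<rightarrow> A" "(\<lambda>u. \<omega> ?y (J (\<gamma> u))) \<midarrow>s\<rightarrow> 0"
    by (simp_all add: isCont_def A_def)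
  obtain d1 where d1: "0 < d1" "\<And>u. u \<noteq> s \<Longrightarrow> \<bar>u - s\<bar> < d1 \<Longrightarrow> \<bar>\<omega> ?x (J (\<gamma> u)) - A\<bar> < A / 2"
    using LIM_D[OF lim(1), of "A / 2"] A by auto
  obtain d2 where d2: "0 < d2" "\<And>u. u \<noteq> s \<Longrightarrow> \<bar>u - s\<bar> < d2 \<Longrightarrow> \<bar>\<omega> ?y (J (\<gamma> u))\<bar> < e * A / 2"
    using LIM_D[OF lim(2), of "e * A / 2"] A e by auto
  have near: "A / 2 < \<omega> ?x (J (\<gamma> u))" "\<bar>\<omega> ?y (J (\<gamma> u))\<bar> \<le> e * A / 2"
    if "\<bar>u - s\<bar> < min d1 d2" for u
  proof -
    have "A / 2 < \<omega> ?x (J (\<gamma> u)) \<and> \<bar>\<omega> ?y (J (\<gamma> u))\<bar> \<le> e * A / 2"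
    proof (cases "u = s")
      case True
      then show ?thesis using A e by (simp flip: A_def)
    next
      case False
      then have "\<bar>\<omega> ?x (J (\<gamma> u)) - A\<bar> < A / 2" "\<bar>\<omega> ?y (J (\<gamma> u))\<bar> < e * A / 2"
        using d1(2)[of u] d2(2)[of u] that by auto
      then show ?thesis by linarith
    qed
    then show "A / 2 < \<omega> ?x (J (\<gamma> u))" "\<bar>\<omega> ?y (J (\<gamma> u))\<bar> \<le> e * A / 2" by auto
  qed
  have half: "rad s v - rad s u \<le> e * \<bar>tang s v - tang s u\<bar>"
    if uv: "\<bar>u - s\<bar> < min d1 d2" for u v
  proof (rule ccontr)
    define \<alpha> \<beta> where "\<alpha> = rad s v - rad s u" and "\<beta> = tang s v - tang s u"
    assume "\<not> ?thesis"
    then have neg: "e * \<bar>\<beta>\<bar> < \<alpha>" by (simp add: \<alpha>_def \<beta>_def)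
    have pos: "0 < \<alpha>" using neg e by (smt (verit) mult_nonneg_nonneg abs_ge_zero)
    have "\<bar>\<omega> (\<gamma> v) (J (\<gamma> u))\<bar> * norm (\<gamma> u) \<le> \<bar>\<omega> (\<gamma> u) (J (\<gamma> u))\<bar> * norm (\<gamma> v)"
      by (rule \<omega>_orth_bound[OF orth_J]) simp
    then have "\<omega> (\<gamma> v) (J (\<gamma> u)) \<le> \<omega> (\<gamma> u) (J (\<gamma> u))"
      using \<omega>_J_pos[of "\<gamma> u"] by simp
    then have "\<omega> (\<gamma> v - \<gamma> u) (J (\<gamma> u)) \<le> 0" by (simp add: \<omega>_linear)
    \<comment> \<open>The supporting line at \<open>\<gamma> u\<close>, written in the frame at
      \<open>s\<close>. By continuity of \<open>J\<close> the coefficient of \<open>\<alpha>\<close>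
      exceeds \<open>A / 2\<close> and that of \<open>\<beta>\<close> is at most
      \<open>e * A / 2\<close> in modulus, so a large \<open>\<alpha>\<close> makes the sum
      positive.\<close>
    then have 1: "\<alpha> * \<omega> ?x (J (\<gamma> u)) + \<beta> * \<omega> ?y (J (\<gamma> u)) \<le> 0"
      unfolding \<gamma>_diff_expand[of v u s] by (simp add: \<omega>_linear \<alpha>_def \<beta>_def)
    have "\<bar>\<beta> * \<omega> ?y (J (\<gamma> u))\<bar> \<le> \<bar>\<beta>\<bar> * (e * A / 2)"
      unfolding abs_mult using near[OF uv] by (intro mult_left_mono) auto
    moreover have "\<bar>\<beta>\<bar> * (e * A / 2) < \<alpha> * (A / 2)"
      using mult_strict_right_mono[OF neg, of "A / 2"] A by (simp add: mult_ac)
    moreover have "\<alpha> * (A / 2) < \<alpha> * \<omega> ?x (J (\<gamma> u))"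
      using near[OF uv] pos by (intro mult_strict_left_mono) auto
    ultimately show False using 1 by linarith
  qed
  show ?thesis
  proof
    show "0 < min d1 d2" using d1 d2 by simp
    fix u v assume "\<bar>u - s\<bar> < min d1 d2" "\<bar>v - s\<bar> < min d1 d2"
    then show "\<bar>rad s v - rad s u\<bar> \<le> e * \<bar>tang s v - tang s u\<bar>"
      using half[of u v] half[of v u] by (simp add: abs_le_iff abs_minus_commute)
  qed
qed

text \<open>Near \<open>s\<close> radial changes are bounded by tangential ones, so equal tangential
  coordinates mean equal points. Thus \<open>tang s\<close> is injective and continuous on an
  interval, hence strictly monotone; \<open>\<sigma>\<close> records in which direction.\<close>

lemma local_orientation:
  "\<exists>\<sigma>. (\<sigma> = 1 \<or> \<sigma> = - 1) \<and> (\<exists>d>0. \<forall>u v. \<bar>u - s\<bar> < d \<longrightarrow> \<bar>v - s\<bar> < d \<longrightarrow> u < v \<longrightarrow>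
     0 < \<sigma> * (tang s v - tang s u))"
proof -
  obtain d where d: "0 < d" "\<And>u v. \<bar>u - s\<bar> < d \<Longrightarrow> \<bar>v - s\<bar> < d \<Longrightarrow>
      \<bar>rad s v - rad s u\<bar> \<le> 1 * \<bar>tang s v - tang s u\<bar>"
    using chord_almost_tangential[of 1] by (metis zero_less_one)
  \<comment> \<open>The bound \<open>L / 2\<close> keeps any two parameters in the interval less
    than a period apart, as \<open>\<gamma>_inj\<close> demands.\<close>
  define b where "b = min d (L / 2)"
  let ?I = "{s - b<..<s + b}"
  have "inj_on (tang s) ?I"
  proof (rule inj_onI)
    fix u v assume uv: "u \<in> ?I" "v \<in> ?I" "tang s u = tang s v"
    then have "rad s u = rad s v" using d(2)[of u v] by (auto simp: b_def)
    then have "\<gamma> u = \<gamma> v" using uv \<gamma>_expand[of u s] \<gamma>_expand[of v s] by simp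
    then show "u = v" using uv by (intro \<gamma>_inj) (auto simp: b_def)
  qed
  then consider "strict_mono_on ?I (tang s)" | "strict_antimono_on ?I (tang s)"
    using injective_eq_monotone_map[of ?I "tang s"] continuous_on_tang[of ?I s] is_interval_oo by blast
  moreover have "0 < b" using d L_pos by (simp add: b_def)
  ultimately show ?thesis
  proof cases
    case 1
    then show ?thesis using \<open>0 < b\<close>
      by (intro exI[of _ 1]) (auto intro!: exI[of _ b] simp: strict_mono_on_def abs_less_iff)
  next
    case 2
    then have "tang s v < tang s u" if "u \<in> ?I" "v \<in> ?I" "u < v" for u v
      using that by (auto simp: monotone_on_def)
    then show ?thesis using \<open>0 < b\<close>
      by (intro exI[of _ "-1"]) (auto intro!: exI[of _ b] simp: abs_less_iff)
  qed
qed

text \<open>A squeeze: tangential displacement is at most the chord, hence at most the arc, while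
  the arc is at most \<open>1 + e\<close> times the tangential displacement. So
  \<open>tang s t\<close> is \<open>\<sigma> * (t - s)\<close> to first order, and the radial change
  is of smaller order.\<close>

lemma \<gamma>_has_derivative_oriented:
  assumes \<sigma>: "\<sigma> = 1 \<or> \<sigma> = - 1"
    and d: "0 < d" "\<And>u v. \<bar>u - s\<bar> < d \<Longrightarrow> \<bar>v - s\<bar> < d \<Longrightarrow> u < v \<Longrightarrow> 0 < \<sigma> * (tang s v - tang s u)"
  shows "(\<gamma> has_vector_derivative \<sigma> *\<^sub>R J (\<gamma> s)) (at s)"
  unfolding has_vector_derivative_def has_derivative_at_alt
proof (intro conjI allI impI)
  show "bounded_linear (\<lambda>h. h *\<^sub>R \<sigma> *\<^sub>R J (\<gamma> s))" by (rule bounded_linear_scaleR_left)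
  fix e0 :: real assume "0 < e0"
  \<comment> \<open>The radial and the tangential error each receive half of
    \<open>e0\<close>.\<close>
  define e where "e = e0 / 2"
  have e: "0 < e" using \<open>0 < e0\<close> by (simp add: e_def)
  obtain d' where d': "0 < d'" "\<And>u v. \<bar>u - s\<bar> < d' \<Longrightarrow> \<bar>v - s\<bar> < d' \<Longrightarrow>
      \<bar>rad s v - rad s u\<bar> \<le> e * \<bar>tang s v - tang s u\<bar>"
    using chord_almost_tangential[OF e] by metis
  define \<delta> where "\<delta> = min (min d d') L"
  have "norm (\<gamma> t - \<gamma> s - (t - s) *\<^sub>R \<sigma> *\<^sub>R J (\<gamma> s)) \<le> e0 * norm (t - s)"
    if t: "norm (t - s) < \<delta>" for t
  proof -
    have chord: "norm (\<gamma> v - \<gamma> u) \<le> (1 + e) * (\<sigma> * tang s v) - (1 + e) * (\<sigma> * tang s u)"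
      if uv: "\<bar>u - s\<bar> < \<delta>" "\<bar>v - s\<bar> < \<delta>" "u \<le> v" for u v
    proof (cases "u = v")
      case False
      then have "0 < \<sigma> * (tang s v - tang s u)" using d(2) uv by (auto simp: \<delta>_def)
      then have "\<bar>tang s v - tang s u\<bar> = \<sigma> * (tang s v - tang s u)" using \<sigma> by auto
      moreover have "norm (\<gamma> v - \<gamma> u) \<le> (1 + e) * \<bar>tang s v - tang s u\<bar>"
        using norm_\<gamma>_diff_le[of v u s] d'(2)[of u v] uv by (simp add: \<delta>_def distrib_right)
      ultimately show ?thesis by (simp add: right_diff_distrib)
    qed simp
    \<comment> \<open>The chord estimate becomes an arc estimate because its right-hand side is an
      increment, here of \<open>h = (\<lambda>u. (1 + e) * (\<sigma> * tang s u))\<close>.\<close>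
    have arc: "v - u \<le> (1 + e) * (\<sigma> * tang s v) - (1 + e) * (\<sigma> * tang s u)"
      if uv: "\<bar>u - s\<bar> < \<delta>" "\<bar>v - s\<bar> < \<delta>" "u \<le> v" "v \<le> u + L" for u v
      by (rule arc_le_of_chord_le[OF uv(3,4)], rule chord) (use uv in auto)
    have le: "\<bar>\<sigma> * tang s t\<bar> \<le> \<bar>t - s\<bar>"
      using tang_diff_le[of s t s] tang_diff_le[of s s t] \<gamma>_chord_le[of s t] \<gamma>_chord_le[of t s] t \<sigma>
      by (cases "s \<le> t") (auto simp: \<delta>_def abs_mult)
    have ge: "\<bar>t - s\<bar> \<le> (1 + e) * \<bar>\<sigma> * tang s t\<bar>" and same: "0 \<le> (t - s) * (\<sigma> * tang s t)"
    proof -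
      consider "s < t" | "t < s" | "s = t" by linarith
      then have "\<bar>t - s\<bar> \<le> (1 + e) * \<bar>\<sigma> * tang s t\<bar> \<and> 0 \<le> (t - s) * (\<sigma> * tang s t)"
      proof cases
        case 1
        then have "0 < \<sigma> * tang s t" using d(2)[of s t] t d by (auto simp: \<delta>_def)
        then show ?thesis using arc[of s t] t 1 by (auto simp: \<delta>_def)
      next
        case 2
        then have "\<sigma> * tang s t < 0" using d(2)[of t s] t d by (auto simp: \<delta>_def)
        then show ?thesis using arc[of t s] t 2 by (auto simp: \<delta>_def mult_nonpos_nonpos)
      qed auto
      then show "\<bar>t - s\<bar> \<le> (1 + e) * \<bar>\<sigma> * tang s t\<bar>" "0 \<le> (t - s) * (\<sigma> * tang s t)" by auto
    qed
    have "\<bar>(t - s) - \<sigma> * tang s t\<bar> = \<bar>t - s\<bar> - \<bar>\<sigma> * tang s t\<bar>"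
      using le same by (cases "0 \<le> t - s"; cases "0 \<le> \<sigma> * tang s t"; simp add: zero_le_mult_iff[of "t - s"])
    also have "\<dots> \<le> e * \<bar>t - s\<bar>"
      using ge[unfolded distrib_right mult_1] mult_left_mono[OF le less_imp_le[OF e]] by linarith
    finally have 1: "\<bar>(t - s) - \<sigma> * tang s t\<bar> \<le> e * \<bar>t - s\<bar>" .
    have "\<bar>rad s t - 1\<bar> \<le> e * \<bar>tang s t\<bar>" using d'(2)[of s t] t d'(1) by (simp add: \<delta>_def)
    also have "\<dots> \<le> e * \<bar>t - s\<bar>" using mult_left_mono[OF le, of e] e \<sigma> by (auto simp: abs_mult)
    finally have 2: "\<bar>rad s t - 1\<bar> \<le> e * \<bar>t - s\<bar>" .
    have \<sigma>2: "\<sigma> * \<sigma> = 1" using \<sigma> by auto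
    have "\<bar>tang s t - (t - s) * \<sigma>\<bar> = \<bar>(t - s) - \<sigma> * tang s t\<bar>"
      using \<sigma> by (auto simp: abs_minus_commute algebra_simps)
    then have 3: "\<bar>tang s t - (t - s) * \<sigma>\<bar> \<le> e * \<bar>t - s\<bar>" using 1 by simp
    have "\<gamma> t - \<gamma> s - (t - s) *\<^sub>R \<sigma> *\<^sub>R J (\<gamma> s) =
      (rad s t - 1) *\<^sub>R \<gamma> s + (tang s t - (t - s) * \<sigma>) *\<^sub>R J (\<gamma> s)"
      by (subst \<gamma>_expand[of t s]) (simp add: algebra_simps)
    also have "norm \<dots> \<le> \<bar>rad s t - 1\<bar> + \<bar>tang s t - (t - s) * \<sigma>\<bar>"
      by (rule order_trans[OF norm_triangle_ineq]) simp
    also have "\<dots> \<le> e0 * \<bar>t - s\<bar>" using 2 3 by (simp add: e_def)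
    finally show ?thesis by simp
  qed
  moreover have "0 < \<delta>" using d d' L_pos by (simp add: \<delta>_def)
  ultimately show "\<exists>\<delta>>0. \<forall>t. norm (t - s) < \<delta> \<longrightarrow>
      norm (\<gamma> t - \<gamma> s - (t - s) *\<^sub>R \<sigma> *\<^sub>R J (\<gamma> s)) \<le> e0 * norm (t - s)"
    by blast
qed

text \<open>The sign found at \<open>s\<close> is locally constant: near \<open>s\<close> the
  function \<open>\<sigma> s * tang s v\<close> of \<open>v\<close> is increasing, and its
  derivative at \<open>u\<close> has the sign of \<open>\<sigma> s * \<sigma> u\<close>.
  Connectedness of the line makes it global.\<close>

lemma \<gamma>_orientation:
  "\<exists>\<sigma>. (\<sigma> = 1 \<or> \<sigma> = - 1) \<and> (\<forall>s. (\<gamma> has_vector_derivative \<sigma> *\<^sub>R J (\<gamma> s)) (at s))"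
proof -
  have "\<exists>\<sigma>. \<forall>s. (\<sigma> s = 1 \<or> \<sigma> s = - 1) \<and> (\<exists>d>0. \<forall>u v. \<bar>u - s\<bar> < d \<longrightarrow> \<bar>v - s\<bar> < d \<longrightarrow> u < v \<longrightarrow>
     0 < \<sigma> s * (tang s v - tang s u))"
    using local_orientation by (intro choice allI)
  then obtain \<sigma> where \<sigma>: "\<And>s. \<sigma> s = 1 \<or> \<sigma> s = - 1"
    "\<And>s. \<exists>d>0. \<forall>u v. \<bar>u - s\<bar> < d \<longrightarrow> \<bar>v - s\<bar> < d \<longrightarrow> u < v \<longrightarrow> 0 < \<sigma> s * (tang s v - tang s u)"
    by blast
  have deriv: "(\<gamma> has_vector_derivative \<sigma> s *\<^sub>R J (\<gamma> s)) (at s)" for s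
    using \<sigma>(2)[of s] \<gamma>_has_derivative_oriented[OF \<sigma>(1)[of s]] by blast
  have const: "\<sigma> s = \<sigma> 0" for s
  proof (rule connected_local_const[of UNIV s 0 \<sigma>])
    show "\<forall>s\<in>UNIV. \<forall>\<^sub>F u in at s. \<sigma> s = \<sigma> u"
    proof
      fix s
      let ?A = "\<omega> (\<gamma> s) (J (\<gamma> s))"
      have A: "0 < ?A" by (simp add: \<omega>_J_pos)
      obtain d where d: "0 < d"
        "\<And>u v. \<bar>u - s\<bar> < d \<Longrightarrow> \<bar>v - s\<bar> < d \<Longrightarrow> u < v \<Longrightarrow> 0 < \<sigma> s * (tang s v - tang s u)"
        using \<sigma>(2)[of s] by blast
      have "continuous_on UNIV (\<lambda>u. \<omega> (\<gamma> s) (J (\<gamma> u)))" by (intro continuous_intros) auto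
      then have "(\<lambda>u. \<omega> (\<gamma> s) (J (\<gamma> u))) \<midarrow>s\<rightarrow> ?A"
        by (auto simp: continuous_on_eq_continuous_at isCont_def)
      then have "\<forall>\<^sub>F u in at s. 0 < \<omega> (\<gamma> s) (J (\<gamma> u))" using A by (rule order_tendstoD)
      moreover have "\<forall>\<^sub>F u in at s. \<bar>u - s\<bar> < d"
        using d(1) by (auto simp: eventually_at dist_real_def)
      ultimately show "\<forall>\<^sub>F u in at s. \<sigma> s = \<sigma> u"
      proof eventually_elim
        case (elim u)
        let ?I = "{s - d<..<s + d}"
        have "mono_on ?I (\<lambda>v. \<sigma> s * tang s v)"
        proof (rule mono_onI)
          fix v w assume vw: "v \<in> ?I" "w \<in> ?I" "v \<le> w"
          then show "\<sigma> s * tang s v \<le> \<sigma> s * tang s w"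
            using d(2)[of v w] by (cases "v = w") (auto simp: abs_less_iff algebra_simps)
        qed
        moreover have "((\<lambda>v. \<sigma> s * tang s v) has_real_derivative
            \<sigma> s * (\<omega> (\<gamma> s) (\<sigma> u *\<^sub>R J (\<gamma> u)) / ?A)) (at u)"
          unfolding tang_def
          by (intro DERIV_cmult DERIV_cdivide)
            (intro bounded_linear.has_vector_derivative[OF
                bounded_bilinear.bounded_linear_right[OF bounded_bilinear_\<omega>] deriv,
                folded has_real_derivative_iff_has_vector_derivative])
        moreover have "u \<in> interior ?I" using elim by (auto simp: abs_less_iff)
        ultimately have "0 \<le> \<sigma> s * (\<omega> (\<gamma> s) (\<sigma> u *\<^sub>R J (\<gamma> u)) / ?A)"
          by (rule mono_on_imp_deriv_nonneg)
        also have "\<dots> = (\<sigma> s * \<sigma> u) * (\<omega> (\<gamma> s) (J (\<gamma> u)) / ?A)" by (simp add: \<omega>_linear)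
        finally have "0 \<le> \<sigma> s * \<sigma> u" using elim A by (simp add: zero_le_mult_iff zero_le_divide_iff)
        then show "\<sigma> s = \<sigma> u" using \<sigma>(1)[of s] \<sigma>(1)[of u] by auto
      qed
    qed
  qed auto
  have "(\<gamma> has_vector_derivative \<sigma> 0 *\<^sub>R J (\<gamma> s)) (at s)" for s
    using deriv[of s] unfolding const[of s] .
  then show ?thesis using \<sigma>(1)[of 0] by blast
qed

text \<open>Tells whether \<open>\<gamma>\<close> runs around the circle in the positive sense of
  \<open>\<omega>\<close>.\<close>

definition \<epsilon> :: real where
  "\<epsilon> = (SOME \<sigma>. (\<sigma> = 1 \<or> \<sigma> = - 1) \<and> (\<forall>s. (\<gamma> has_vector_derivative \<sigma> *\<^sub>R J (\<gamma> s)) (at s)))"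

lemma \<epsilon>_cases: "\<epsilon> = 1 \<or> \<epsilon> = - 1"
  and \<gamma>_deriv: "(\<gamma> has_vector_derivative \<epsilon> *\<^sub>R J (\<gamma> s)) (at s)"
  using someI_ex[OF \<gamma>_orientation] unfolding \<epsilon>_def by blast+

lemma \<epsilon>_mult_self [simp]: "\<epsilon> * \<epsilon> = 1" "\<epsilon> * (\<epsilon> * x) = x"
  using \<epsilon>_cases by auto

end

section \<open>Continuously differentiable Birkhoff map\<close>

lemma vector_derivative_quotient_tendsto:
  assumes "(f has_vector_derivative f') (at x within S)"
  shows "((\<lambda>y. (f y - f x) /\<^sub>R (y - x)) \<longlongrightarrow> f') (at x within S)"
proof -
  have "((\<lambda>y. (1 / norm (y - x)) *\<^sub>R (f y - (f x + (y - x) *\<^sub>R f'))) \<longlongrightarrow> 0) (at x within S)"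
    using assms by (simp add: has_vector_derivative_def has_derivative_within)
  then have "((\<lambda>y. norm ((1 / norm (y - x)) *\<^sub>R (f y - (f x + (y - x) *\<^sub>R f')))) \<longlongrightarrow> 0) (at x within S)"
    by (rule tendsto_norm_zero)
  then have "((\<lambda>y. norm ((f y - f x) /\<^sub>R (y - x) - f')) \<longlongrightarrow> 0) (at x within S)"
  proof (rule Lim_transform_eventually)
    show "\<forall>\<^sub>F y in at x within S. norm ((1 / norm (y - x)) *\<^sub>R (f y - (f x + (y - x) *\<^sub>R f'))) =
      norm ((f y - f x) /\<^sub>R (y - x) - f')"
      unfolding eventually_at
    proof (intro exI[of _ 1] conjI ballI impI)
      fix y assume "y \<noteq> x \<and> dist y x < 1"
      then have ne: "y - x \<noteq> 0" by simp
      define E where "E = (f y - f x) /\<^sub>R (y - x) - f'"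
      have eq: "f y - (f x + (y - x) *\<^sub>R f') = (y - x) *\<^sub>R E"
        unfolding E_def scaleR_diff_right scaleR_scaleR right_inverse[OF ne] by simp
      have "\<bar>1 / norm (y - x)\<bar> * (\<bar>y - x\<bar> * norm E) = norm E"
        unfolding real_norm_def abs_divide abs_one abs_idempotent using ne by (simp del: right_minus_eq)
      then show "norm ((1 / norm (y - x)) *\<^sub>R (f y - (f x + (y - x) *\<^sub>R f'))) =
        norm ((f y - f x) /\<^sub>R (y - x) - f')"
        unfolding eq norm_scaleR E_def[symmetric] .
    qed simp
  qed
  then have "((\<lambda>y. (f y - f x) /\<^sub>R (y - x) - f') \<longlongrightarrow> 0) (at x within S)"
    by (rule tendsto_norm_zero_cancel)
  then show ?thesis by (rule LIM_zero_cancel)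
qed

locale radon_circle_C1 = radon_circle \<gamma> r L
  for \<gamma> :: "real \<Rightarrow> 'a::real_normed_vector" and r :: "real \<Rightarrow> real" and L :: real +
  fixes \<kappa> :: "real \<Rightarrow> real"
  assumes continuous_\<kappa>: "continuous_on {0..L} \<kappa>"
    and r_deriv: "s \<in> {0..L} \<Longrightarrow> (r has_real_derivative \<kappa> s) (at s within {0..L})"
begin

abbreviation \<eta> :: "real \<Rightarrow> 'a" where "\<eta> s \<equiv> J (\<gamma> s)"

lemma \<gamma>_orth_r:
  assumes "s \<in> {0..L}"
  shows "\<gamma> s \<bottom>\<^sub>B \<gamma> (r s)"
  using assms birkhoff by (simp add: birkhoff_param_def)

text \<open>Pointwise, \<open>\<gamma> (r s)\<close> could be either of two antipodes. Continuity of
  \<open>r\<close> makes the sign, written as the area ratio \<open>q\<close>, continuous; a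
  continuous function with finitely many values on an interval is constant.\<close>

lemma \<gamma>_r: "\<exists>\<delta>. (\<delta> = 1 \<or> \<delta> = - 1) \<and> (\<forall>s\<in>{0..L}. \<gamma> (r s) = \<delta> *\<^sub>R \<eta> s)"
proof -
  define q where "q s = \<omega> (\<gamma> s) (\<gamma> (r s)) / \<omega> (\<gamma> s) (\<eta> s)" for s
  have pm: "(q s = 1 \<or> q s = - 1) \<and> \<gamma> (r s) = q s *\<^sub>R \<eta> s" if s: "s \<in> {0..L}" for s
  proof -
    have "\<gamma> (r s) = \<eta> s \<or> \<gamma> (r s) = - \<eta> s"
      using orth_unique[OF norm_\<gamma>[of s] _ norm_\<gamma>[of "r s"] orth_J \<gamma>_orth_r[OF s]] by simp
    then show ?thesis using \<omega>_J_pos[of "\<gamma> s"] by (auto simp: q_def \<omega>_linear)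
  qed
  have "continuous_on {0..L} r"
    using r_deriv by (meson DERIV_continuous_on)
  then have "continuous_on {0..L} q"
    unfolding q_def by (intro continuous_intros) (use \<omega>_J_pos in \<open>auto simp: less_imp_neq[symmetric]\<close>)
  moreover have "finite (q ` {0..L})"
    by (rule finite_subset[of _ "{1, - 1}"], rule image_subsetI) (use pm in blast, simp)
  ultimately have "q constant_on {0..L}" by (intro continuous_finite_range_constant) auto
  then obtain \<delta> where "\<And>s. s \<in> {0..L} \<Longrightarrow> q s = \<delta>" by (auto simp: constant_on_def)
  moreover have "0 \<in> {0..L}" using L_pos by simp
  ultimately show ?thesis using pm by metis
qed

lemma \<gamma>_deriv_within: "(\<gamma> has_vector_derivative \<epsilon> *\<^sub>R \<eta> s) (at s within S)"
  using \<gamma>_deriv by (rule has_vector_derivative_at_within)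

text \<open>Up to the constant sign \<open>\<delta>\<close>, \<open>\<eta>\<close> is
  \<open>\<gamma> \<circ> r\<close>, so the chain rule applies; \<open>J_J\<close> turns
  \<open>\<eta> (r s)\<close> back into a multiple of \<open>\<gamma> s\<close>.\<close>

lemma \<eta>_deriv:
  assumes s: "s \<in> {0..L}"
  shows "(\<eta> has_vector_derivative - (\<epsilon> * \<kappa> s) *\<^sub>R \<gamma> s) (at s within {0..L})"
proof -
  obtain \<delta> where \<delta>: "\<delta> = 1 \<or> \<delta> = - 1" "\<And>s. s \<in> {0..L} \<Longrightarrow> \<gamma> (r s) = \<delta> *\<^sub>R \<eta> s"
    using \<gamma>_r by blast
  have "((\<gamma> \<circ> r) has_vector_derivative \<kappa> s *\<^sub>R (\<epsilon> *\<^sub>R \<eta> (r s))) (at s within {0..L})"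
    by (rule vector_diff_chain_within[OF _ \<gamma>_deriv_within])
      (use r_deriv[OF s] in \<open>simp add: has_real_derivative_iff_has_vector_derivative\<close>)
  then have "((\<lambda>t. \<delta> *\<^sub>R (\<gamma> \<circ> r) t) has_vector_derivative \<delta> *\<^sub>R \<kappa> s *\<^sub>R (\<epsilon> *\<^sub>R \<eta> (r s))) (at s within {0..L})"
    by (rule bounded_linear.has_vector_derivative[OF bounded_linear_scaleR_right])
  then have "(\<eta> has_vector_derivative \<delta> *\<^sub>R \<kappa> s *\<^sub>R (\<epsilon> *\<^sub>R \<eta> (r s))) (at s within {0..L})"
    by (rule has_vector_derivative_transform[OF s, rotated]) (use \<delta> in auto)
  moreover have "\<eta> (r s) = - \<delta> *\<^sub>R \<gamma> s"
    using \<delta>(1) J_J[of "\<gamma> s"] by (auto simp: \<delta>(2)[OF s] J_minus)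
  ultimately show ?thesis using \<delta>(1) by (auto simp: mult.commute)
qed

section \<open>Supporting functionals as derivatives of the norm\<close>

definition A :: real where "A = \<omega> (\<gamma> 0) (\<eta> 0)"

lemma A_pos: "0 < A"
  by (simp add: A_def \<omega>_J_pos)

text \<open>Differentiating \<open>\<omega> (\<gamma> s) (\<eta> s)\<close> leaves only multiples of
  \<open>\<omega> (\<eta> s) (\<eta> s)\<close> and
  \<open>\<omega> (\<gamma> s) (\<gamma> s)\<close>, both zero. Homogeneity extends the constant
  from unit vectors to all others.\<close>

lemma \<omega>_J:
  assumes "x \<noteq> 0"
  shows "\<omega> x (J x) = A * norm x"
proof -
  have "((\<lambda>s. \<omega> (\<gamma> s) (\<eta> s)) has_vector_derivative 0) (at s within {0..L})" if s: "s \<in> {0..L}" for s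
    using bounded_bilinear.has_vector_derivative[OF bounded_bilinear_\<omega> \<gamma>_deriv_within \<eta>_deriv[OF s]]
    by (simp add: \<omega>_linear)
  then obtain c where c: "\<And>s. s \<in> {0..L} \<Longrightarrow> \<omega> (\<gamma> s) (\<eta> s) = c"
    using has_field_derivative_zero_constant[of "{0..L}" "\<lambda>s. \<omega> (\<gamma> s) (\<eta> s)"]
    by (auto simp: has_real_derivative_iff_has_vector_derivative)
  then have "\<omega> (\<gamma> s) (\<eta> s) = A" if "s \<in> {0..L}" for s
    using c[OF that] c[of 0] L_pos by (simp add: A_def)
  moreover obtain s where "s \<in> {0..L}" "\<gamma> s = x /\<^sub>R norm x"
    using \<gamma>_surj[of "x /\<^sub>R norm x"] assms by auto
  ultimately have "\<omega> (x /\<^sub>R norm x) (J (x /\<^sub>R norm x)) = A" by metis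
  then show ?thesis using assms by (simp add: J_scaleR \<omega>_linear field_simps)
qed

text \<open>For nonzero \<open>p\<close> this is the supporting functional of the norm at
  \<open>p\<close>: it vanishes on \<open>J p\<close>, takes the value \<open>norm p\<close> at
  \<open>p\<close> and never exceeds the norm.\<close>

definition D :: "'a \<Rightarrow> 'a \<Rightarrow> real" where "D p v = \<omega> v (J p) / A"

lemma D_self: "p \<noteq> 0 \<Longrightarrow> D p p = norm p"
  using A_pos by (simp add: D_def \<omega>_J)

lemma D_le:
  assumes "p \<noteq> 0"
  shows "D p v \<le> norm v"
proof -
  have "\<bar>\<omega> v (J p)\<bar> * norm p \<le> (A * norm v) * norm p"
    using \<omega>_orth_bound[OF orth_J[OF assms], of v] A_pos assms by (simp add: \<omega>_J abs_mult mult_ac)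
  then have "\<bar>\<omega> v (J p)\<bar> \<le> A * norm v"
    by (rule mult_right_le_imp_le) (use assms in simp)
  then show ?thesis using A_pos by (simp add: D_def field_simps)
qed

lemma D_linear:
  "D p (x + y) = D p x + D p y" "D p (x - y) = D p x - D p y" "D p (c *\<^sub>R x) = c * D p x" "D p (- x) = - D p x"
  by (simp_all add: D_def \<omega>_linear add_divide_distrib diff_divide_distrib)

lemma bounded_linear_D: "bounded_linear (D p)"
  unfolding D_def divide_inverse
  by (intro bounded_linear_mult_const bounded_bilinear.bounded_linear_left[OF bounded_bilinear_\<omega>])

text \<open>The supporting functionals at \<open>p\<close> and \<open>q\<close> squeeze
  \<open>norm q - norm p\<close> between \<open>D p (q - p)\<close> and \<open>D q (q - p)\<close>.
  These differ by \<open>\<omega> (q - p) (J q - J p) / A\<close>, which is small by continuity of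
  \<open>J\<close>.\<close>

lemma norm_has_derivative_D:
  assumes p: "p \<noteq> 0"
  shows "(norm has_derivative D p) (at p)"
  unfolding has_derivative_at_alt
proof (intro conjI allI impI bounded_linear_D)
  fix e :: real assume e: "0 < e"
  obtain K where K: "0 < K" "\<And>x y. norm (\<omega> x y) \<le> norm x * norm y * K"
    using bounded_bilinear.pos_bounded[OF bounded_bilinear_\<omega>] by blast
  have "isCont J p"
    using continuous_on_J p by (simp add: continuous_on_eq_continuous_at[OF open_Compl[OF closed_singleton]])
  then obtain d where d: "0 < d" "\<And>q. dist q p < d \<Longrightarrow> dist (J q) (J p) < e * A / K"
    using e K(1) A_pos
    by (metis continuous_at_eps_delta divide_pos_pos mult_pos_pos)
  have "\<bar>norm q - norm p - D p (q - p)\<bar> \<le> e * norm (q - p)"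
    if q: "norm (q - p) < min d (norm p)" for q
  proof -
    have q0: "q \<noteq> 0" using q by auto
    have "D p q \<le> norm q" "D q p \<le> norm p" using D_le p q0 by auto
    then have "\<bar>norm q - norm p - D p (q - p)\<bar> \<le> D q (q - p) - D p (q - p)"
      using D_self[OF p] D_self[OF q0] by (simp add: D_linear)
    also have "\<dots> = \<omega> (q - p) (J q - J p) / A"
      by (simp add: D_def \<omega>_linear diff_divide_distrib)
    also have "\<dots> \<le> (norm (q - p) * norm (J q - J p) * K) / A"
      using K(2)[of "q - p" "J q - J p"] A_pos by (intro divide_right_mono) auto
    also have "\<dots> \<le> (norm (q - p) * (e * A / K) * K) / A"
      using d(2)[of q] q K(1) A_pos
      by (intro divide_right_mono mult_right_mono mult_left_mono) (auto simp: dist_norm less_imp_le)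
    also have "\<dots> = e * norm (q - p)" using K(1) A_pos by simp
    finally show ?thesis .
  qed
  then show "\<exists>d>0. \<forall>q. norm (q - p) < d \<longrightarrow> norm (norm q - norm p - D p (q - p)) \<le> e * norm (q - p)"
    using d(1) p by (intro exI[of _ "min d (norm p)"]) auto
qed

lemma norm_deriv:
  assumes "(c has_vector_derivative c') (at t within S)" "c t \<noteq> 0"
  shows "((\<lambda>t. norm (c t)) has_real_derivative D (c t) c') (at t within S)"
proof -
  have "((\<lambda>t. norm (c t)) has_derivative (\<lambda>h. D (c t) (h *\<^sub>R c'))) (at t within S)"
    using assms(1) norm_has_derivative_D[OF assms(2)] unfolding has_vector_derivative_def
    by (rule has_derivative_compose)
  moreover have "(\<lambda>h. D (c t) (h *\<^sub>R c')) = (*) (D (c t) c')"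
    by (rule ext) (simp add: D_linear)
  ultimately show ?thesis by (simp only: has_field_derivative_def)
qed

lemma continuous_on_D [continuous_intros]:
  "continuous_on S f \<Longrightarrow> continuous_on S g \<Longrightarrow> (\<And>x. x \<in> S \<Longrightarrow> f x \<noteq> 0) \<Longrightarrow>
    continuous_on S (\<lambda>x. D (f x) (g x))"
  unfolding D_def using A_pos by (intro continuous_intros) auto

section \<open>A family of loops and a closed form\<close>

definition P :: "real \<Rightarrow> real \<Rightarrow> 'a" where
  "P \<theta> s = cos \<theta> *\<^sub>R \<gamma> s + sin \<theta> *\<^sub>R \<eta> s"

lemma P_nonzero [simp]: "P \<theta> s \<noteq> 0"
proof
  assume "P \<theta> s = 0"
  then have "cos \<theta> = 0" "sin \<theta> = 0"
    using birkhoff_orth_bound[OF orth_J[of "\<gamma> s"], of "cos \<theta>" "sin \<theta>"]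
      birkhoff_orth_bound[OF orth_sym[OF orth_J[of "\<gamma> s"]], of "sin \<theta>" "cos \<theta>"]
    by (simp_all add: P_def add.commute)
  then show False using sin_cos_squared_add[of \<theta>] by simp
qed

lemma P_period: "P \<theta> L = P \<theta> 0"
  using \<gamma>_periodic[of 0 1] by (simp add: P_def)

lemma P_deriv_\<theta>:
  "((\<lambda>\<theta>. P \<theta> s) has_vector_derivative cos \<theta> *\<^sub>R \<eta> s - sin \<theta> *\<^sub>R \<gamma> s) (at \<theta> within S)"
  unfolding P_def
  by (rule has_vector_derivative_eq_rhs)
    (auto intro!: derivative_eq_intros simp: has_real_derivative_iff_has_vector_derivative[symmetric])

lemma P_deriv_s:
  assumes s: "s \<in> {0..L}"
  shows "(P \<theta> has_vector_derivative \<epsilon> *\<^sub>R (cos \<theta> *\<^sub>R \<eta> s - (sin \<theta> * \<kappa> s) *\<^sub>R \<gamma> s)) (at s within {0..L})"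
proof -
  have "((\<lambda>s. cos \<theta> *\<^sub>R \<gamma> s + sin \<theta> *\<^sub>R \<eta> s) has_vector_derivative
      cos \<theta> *\<^sub>R \<epsilon> *\<^sub>R \<eta> s + sin \<theta> *\<^sub>R (- (\<epsilon> * \<kappa> s) *\<^sub>R \<gamma> s)) (at s within {0..L})"
    by (intro has_vector_derivative_add \<gamma>_deriv_within \<eta>_deriv[OF s]
        bounded_linear.has_vector_derivative[OF bounded_linear_scaleR_right])
  then show ?thesis by (simp add: P_def[abs_def] algebra_simps)
qed

text \<open>
  Up to the factor \<open>A\<close> and a sign, \<open>F \<theta> s ds\<close> is the pullback along \<open>P \<theta>\<close> of the closed form
  \<open>\<omega> x dx / (norm x)\<^sup>2\<close>, whose integral over a loop is a homotopy invariant.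
\<close>

definition F :: "real \<Rightarrow> real \<Rightarrow> real" where
  "F \<theta> s = ((cos \<theta>)\<^sup>2 + (sin \<theta>)\<^sup>2 * \<kappa> s) / (norm (P \<theta> s))\<^sup>2"

text \<open>The common value of two derivatives: of \<open>F \<theta> s\<close> in
  \<open>\<theta>\<close> and of \<open>\<epsilon> / (norm (P \<theta> s))\<^sup>2\<close> in
  \<open>s\<close>.\<close>

definition F' :: "real \<Rightarrow> real \<Rightarrow> real" where
  "F' \<theta> s = 2 * D (P \<theta> s) ((sin \<theta> * \<kappa> s) *\<^sub>R \<gamma> s - cos \<theta> *\<^sub>R \<eta> s) / norm (P \<theta> s) ^ 3"

lemma F_deriv: "((\<lambda>\<theta>. F \<theta> s) has_real_derivative F' \<theta> s) (at \<theta> within S)"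
proof -
  let ?N = "norm (P \<theta> s)"
  define a b k C Z where defs: "a = D (P \<theta> s) (\<gamma> s)" "b = D (P \<theta> s) (\<eta> s)" "k = \<kappa> s"
    "C = cos \<theta>" "Z = sin \<theta>"
  \<comment> \<open>Euler's relation for the homogeneous norm; it lets the numerator factor through
    \<open>C\<^sup>2 + Z\<^sup>2\<close>.\<close>
  have N: "?N = C * a + Z * b"
    using D_self[of "P \<theta> s"] by (simp add: defs) (simp add: P_def D_linear)
  have CZ: "C\<^sup>2 + Z\<^sup>2 = 1" by (simp add: defs)
  have pos: "?N \<noteq> 0" by simp
  have "((\<lambda>\<theta>. F \<theta> s) has_real_derivative
     ((2 * Z * C * (k - 1)) * ?N\<^sup>2 - (C\<^sup>2 + Z\<^sup>2 * k) * (2 * ?N * (C * b - Z * a))) / (?N\<^sup>2 * ?N\<^sup>2))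
     (at \<theta> within S)"
    unfolding F_def defs
    by (rule derivative_eq_intros norm_deriv[OF P_deriv_\<theta>] refl | simp)+
      (simp add: D_linear power2_eq_square algebra_simps)
  moreover have "(2 * Z * C * (k - 1)) * ?N\<^sup>2 - (C\<^sup>2 + Z\<^sup>2 * k) * (2 * ?N * (C * b - Z * a))
      = 2 * (Z * k * a - C * b) * ?N"
  proof -
    have "(2 * Z * C * (k - 1)) * ?N\<^sup>2 - (C\<^sup>2 + Z\<^sup>2 * k) * (2 * ?N * (C * b - Z * a))
      = 2 * ?N * (Z * C * (k - 1) * (C * a + Z * b) - (C\<^sup>2 + Z\<^sup>2 * k) * (C * b - Z * a))"
      by (simp add: power2_eq_square N algebra_simps)
    also have "Z * C * (k - 1) * (C * a + Z * b) - (C\<^sup>2 + Z\<^sup>2 * k) * (C * b - Z * a)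
      = (C\<^sup>2 + Z\<^sup>2) * (Z * k * a - C * b)" by algebra
    finally show ?thesis by (simp add: CZ)
  qed
  ultimately show ?thesis
    using pos by (simp add: F'_def D_linear defs power2_eq_square power3_eq_cube mult.assoc)
qed

text \<open>Up to the factor \<open>A\<close>, the closed form pulled back to the
  \<open>(\<theta>, s)\<close> plane has \<open>\<theta>\<close>-component
  \<open>1 / (norm (P \<theta> s))\<^sup>2\<close> and \<open>s\<close>-component
  \<open>\<epsilon> * F \<theta> s\<close>. Closedness equates the mixed derivatives, and this is
  the second of them.\<close>

lemma inverse_norm_P_deriv:
  assumes s: "s \<in> {0..L}"
  shows "((\<lambda>s. \<epsilon> / (norm (P \<theta> s))\<^sup>2) has_real_derivative F' \<theta> s) (at s within {0..L})"
proof -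
  have "((\<lambda>s. \<epsilon> / (norm (P \<theta> s))\<^sup>2) has_real_derivative
     (- \<epsilon> * (2 * norm (P \<theta> s) * D (P \<theta> s) (\<epsilon> *\<^sub>R (cos \<theta> *\<^sub>R \<eta> s - (sin \<theta> * \<kappa> s) *\<^sub>R \<gamma> s))))
       / ((norm (P \<theta> s))\<^sup>2 * (norm (P \<theta> s))\<^sup>2)) (at s within {0..L})"
    by (rule derivative_eq_intros norm_deriv[OF P_deriv_s[OF s]] refl | simp)+
  moreover have "(- \<epsilon> * (2 * norm (P \<theta> s) * D (P \<theta> s) (\<epsilon> *\<^sub>R (cos \<theta> *\<^sub>R \<eta> s - (sin \<theta> * \<kappa> s) *\<^sub>R \<gamma> s))))
      = (\<epsilon> * \<epsilon>) * (2 * D (P \<theta> s) ((sin \<theta> * \<kappa> s) *\<^sub>R \<gamma> s - cos \<theta> *\<^sub>R \<eta> s)) * norm (P \<theta> s)"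
    unfolding D_linear by algebra
  moreover have "(2 * d * n) / (n\<^sup>2 * n\<^sup>2) = 2 * d / n ^ 3" if "n \<noteq> 0" for d n :: real
    using that by (simp add: power2_eq_square power3_eq_cube)
  ultimately show ?thesis by (simp only: F'_def \<epsilon>_mult_self mult_1_left norm_eq_zero P_nonzero not_False_eq_True)
qed

lemma continuous_on_F: "continuous_on {0..L} (F \<theta>)"
  unfolding F_def P_def[abs_def]
  by (intro continuous_intros continuous_\<kappa>) (auto simp flip: P_def)

text \<open>Under the integral sign the derivative in \<open>\<theta>\<close> is a derivative in
  \<open>s\<close> of a function with equal end values, so the integral does not depend on
  \<open>\<theta>\<close>; at \<open>\<theta> = 0\<close> the integrand is 1.\<close>

lemma integral_F: "integral {0..L} (F \<theta>) = L"
proof -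
  have cont: "continuous_on (UNIV \<times> cbox 0 L) (\<lambda>(\<theta>, s). F' \<theta> s)"
    unfolding F'_def P_def split_beta
    by (intro continuous_intros continuous_on_compose2[OF continuous_\<kappa>]) (auto simp flip: P_def)
  have "((\<lambda>\<theta>. integral (cbox 0 L) (F \<theta>)) has_real_derivative integral (cbox 0 L) (F' \<theta>)) (at \<theta>)" for \<theta>
    by (rule leibniz_rule_field_derivative[OF _ _ cont])
      (auto intro: F_deriv integrable_continuous_interval continuous_on_F)
  moreover have "integral (cbox 0 L) (F' \<theta>) = 0" for \<theta>
  proof -
    have "(F' \<theta> has_integral (\<epsilon> / (norm (P \<theta> L))\<^sup>2 - \<epsilon> / (norm (P \<theta> 0))\<^sup>2)) {0..L}"
      using inverse_norm_P_deriv L_pos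
      by (intro fundamental_theorem_of_calculus) (auto simp: has_real_derivative_iff_has_vector_derivative)
    then show ?thesis by (simp add: P_period integral_unique)
  qed
  ultimately have "((\<lambda>\<theta>. integral (cbox 0 L) (F \<theta>)) has_real_derivative 0) (at \<theta>)" for \<theta>
    by metis
  then have "integral (cbox 0 L) (F \<theta>) = integral (cbox 0 L) (F 0)"
    by (intro DERIV_isconst_all) auto
  also have "F 0 = (\<lambda>s. 1)" by (auto simp: F_def P_def)
  finally show ?thesis using L_pos by simp
qed

lemma integral_\<kappa>: "integral {0..L} \<kappa> = L"
proof -
  have "F (pi / 2) = \<kappa>" by (rule ext) (simp add: F_def P_def)
  then show ?thesis using integral_F[of "pi / 2"] by simp
qed

lemma integral_norm_add: "integral {0..L} (\<lambda>s. (1 + \<kappa> s) / (norm (\<gamma> s + \<eta> s))\<^sup>2) = L"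
proof -
  have "F (pi / 4) s = (1 + \<kappa> s) / (norm (\<gamma> s + \<eta> s))\<^sup>2" for s
  proof -
    have "P (pi / 4) s = (sqrt 2 / 2) *\<^sub>R (\<gamma> s + \<eta> s)"
      by (simp add: P_def cos_45 sin_45 scaleR_add_right)
    then have "(norm (P (pi / 4) s))\<^sup>2 = (norm (\<gamma> s + \<eta> s))\<^sup>2 / 2"
      by (simp add: power_mult_distrib power_divide)
    moreover have "(cos (pi / 4))\<^sup>2 + (sin (pi / 4))\<^sup>2 * \<kappa> s = (1 + \<kappa> s) / 2"
      by (simp add: cos_45 sin_45 power_divide add_divide_distrib)
    moreover have "(a / 2) / (b / 2) = a / b" for a b :: real by simp
    ultimately show ?thesis by (simp only: F_def)
  qed
  then have "F (pi / 4) = (\<lambda>s. (1 + \<kappa> s) / (norm (\<gamma> s + \<eta> s))\<^sup>2)" by (rule ext)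
  then show ?thesis using integral_F[of "pi / 4"] by simp
qed

lemma integral_norm_diff: "integral {0..L} (\<lambda>s. (1 + \<kappa> s) / (norm (\<gamma> s - \<eta> s))\<^sup>2) = L"
proof -
  have "F (- (pi / 4)) s = (1 + \<kappa> s) / (norm (\<gamma> s - \<eta> s))\<^sup>2" for s
  proof -
    have "P (- (pi / 4)) s = (sqrt 2 / 2) *\<^sub>R (\<gamma> s - \<eta> s)"
      by (simp add: P_def cos_45 sin_45 scaleR_diff_right)
    then have "(norm (P (- (pi / 4)) s))\<^sup>2 = (norm (\<gamma> s - \<eta> s))\<^sup>2 / 2"
      by (simp add: power_mult_distrib power_divide)
    moreover have "(cos (- (pi / 4)))\<^sup>2 + (sin (- (pi / 4)))\<^sup>2 * \<kappa> s = (1 + \<kappa> s) / 2"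
      by (simp add: cos_45 sin_45 power_divide add_divide_distrib)
    moreover have "(a / 2) / (b / 2) = a / b" for a b :: real by simp
    ultimately show ?thesis by (simp only: F_def)
  qed
  then have "F (- (pi / 4)) = (\<lambda>s. (1 + \<kappa> s) / (norm (\<gamma> s - \<eta> s))\<^sup>2)" by (rule ext)
  then show ?thesis using integral_F[of "- (pi / 4)"] by simp
qed

section \<open>Convexity, and orthogonality through the area form\<close>

text \<open>The two supporting lines at \<open>\<gamma> s\<close> and \<open>\<gamma> t\<close> give
  a monotonicity inequality for increments. Divided by \<open>(t - s)\<^sup>2\<close> it tends to
  \<open>A * \<kappa> s\<close>. The sign makes the weight \<open>1 + \<kappa> s\<close> positive in
  the equality argument for the diagonals.\<close>

lemma \<kappa>_nonneg:
  assumes s: "s \<in> {0..L}"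
  shows "0 \<le> \<kappa> s"
proof -
  have mono: "0 \<le> \<omega> (\<gamma> t - \<gamma> s) (\<eta> t - \<eta> s)" for t
  proof -
    have "D (\<gamma> s) (\<gamma> t) \<le> 1" "D (\<gamma> t) (\<gamma> s) \<le> 1" using D_le[of "\<gamma> s" "\<gamma> t"] D_le[of "\<gamma> t" "\<gamma> s"] by auto
    then have "\<omega> (\<gamma> t) (\<eta> s) \<le> A" "\<omega> (\<gamma> s) (\<eta> t) \<le> A" using A_pos by (simp_all add: D_def)
    then show ?thesis by (simp add: \<omega>_linear \<omega>_J)
  qed
  have "((\<lambda>t. \<omega> ((\<gamma> t - \<gamma> s) /\<^sub>R (t - s)) ((\<eta> t - \<eta> s) /\<^sub>R (t - s))) \<longlongrightarrow>
      \<omega> (\<epsilon> *\<^sub>R \<eta> s) (- (\<epsilon> * \<kappa> s) *\<^sub>R \<gamma> s)) (at s within {0..L})"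
    by (intro tendsto_\<omega> vector_derivative_quotient_tendsto \<gamma>_deriv_within \<eta>_deriv s)
  moreover have "\<omega> (\<epsilon> *\<^sub>R \<eta> s) (- (\<epsilon> * \<kappa> s) *\<^sub>R \<gamma> s) = A * \<kappa> s"
    by (simp add: \<omega>_linear mult.assoc mult.left_commute[of "\<kappa> s"] \<omega>_commute[of "\<eta> s" "\<gamma> s"] \<omega>_J)
  moreover have "0 \<le> \<omega> ((\<gamma> t - \<gamma> s) /\<^sub>R (t - s)) ((\<eta> t - \<eta> s) /\<^sub>R (t - s))" for t
    unfolding bounded_bilinear.scaleR_left[OF bounded_bilinear_\<omega>]
      bounded_bilinear.scaleR_right[OF bounded_bilinear_\<omega>] real_scaleR_def mult.assoc[symmetric]
    by (intro mult_nonneg_nonneg zero_le_square mono)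
  moreover have "at s within {0..L} \<noteq> bot"
    using s L_pos by (simp add: trivial_limit_within islimpt_Icc)
  ultimately have "0 \<le> A * \<kappa> s"
    by (metis (no_types, lifting) always_eventually tendsto_lowerbound)
  then show ?thesis using A_pos by (simp add: zero_le_mult_iff)
qed

lemma orth_eq_J:
  assumes "p \<noteq> 0" "v \<noteq> 0" "p \<bottom>\<^sub>B v"
  shows "v = norm v *\<^sub>R J p \<or> v = - norm v *\<^sub>R J p"
proof -
  have *: "J p = v /\<^sub>R norm v" if "0 \<le> \<omega> p v" "v \<noteq> 0" "p \<bottom>\<^sub>B v" for v
    using that birkhoff_orth_scaleR[of p v 1 "inverse (norm v)"] assms(1)
    by (intro J_eqI) (auto simp: \<omega>_linear)
  have "p \<bottom>\<^sub>B (- v)" using birkhoff_orth_scaleR[OF assms(3), of 1 "-1"] by simp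
  then show ?thesis
    using *[of v] *[of "- v"] assms by (cases "0 \<le> \<omega> p v") (auto simp: \<omega>_linear)
qed

lemma orth_iff_\<omega>_J:
  assumes "p \<noteq> 0" "v \<noteq> 0"
  shows "p \<bottom>\<^sub>B v \<longleftrightarrow> \<omega> v (J p) = 0"
proof
  assume "p \<bottom>\<^sub>B v"
  then obtain c where c: "v = c *\<^sub>R J p" using orth_eq_J[OF assms] by blast
  show "\<omega> v (J p) = 0" unfolding c by (simp add: \<omega>_linear)
next
  assume "\<omega> v (J p) = 0"
  then have "v = (\<omega> p v / \<omega> p (J p)) *\<^sub>R J p"
    using cramer_div[of p "J p" v] \<omega>_J_pos[OF assms(1)] by simp
  then show "p \<bottom>\<^sub>B v" using birkhoff_orth_scaleR[OF orth_J[OF assms(1)], of 1] by (metis scaleR_one)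
qed

lemma abs_\<omega>_orth:
  assumes "p \<noteq> 0" "v \<noteq> 0" "p \<bottom>\<^sub>B v"
  shows "\<bar>\<omega> p v\<bar> = A * norm p * norm v"
proof -
  obtain c where c: "v = c *\<^sub>R J p" using orth_eq_J[OF assms] by blast
  show ?thesis unfolding c using A_pos assms(1) by (simp add: \<omega>_linear \<omega>_J abs_mult)
qed

end

section \<open>The hyperbola condition\<close>

locale radon_circle_hyperbola = radon_circle_C1 \<gamma> r L \<kappa>
  for \<gamma> :: "real \<Rightarrow> 'a::real_normed_vector" and r :: "real \<Rightarrow> real" and L :: real
    and \<kappa> :: "real \<Rightarrow> real" +
  assumes hyperbola: "s \<in> {0..L} \<Longrightarrow> 0 < t \<Longrightarrow>
    norm (\<gamma> s - \<gamma> (r s)) \<le> norm (t *\<^sub>R \<gamma> s - inverse t *\<^sub>R \<gamma> (r s))"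
begin

lemma add_diff_nonzero: "\<gamma> s + \<eta> s \<noteq> 0" "\<gamma> s - \<eta> s \<noteq> 0"
  using birkhoff_orth_bound[OF orth_J[of "\<gamma> s"], of 1 1]
    birkhoff_orth_bound[OF orth_J[of "\<gamma> s"], of 1 "-1"] by auto

text \<open>The curve in the hyperbola condition has velocity
  \<open>\<gamma> s + \<gamma> (r s)\<close> at \<open>t = 1\<close>, where its norm is minimal, so
  the supporting functional at \<open>\<gamma> s - \<gamma> (r s)\<close> vanishes on that
  velocity.\<close>

lemma diagonals_orth:
  assumes s: "s \<in> {0..L}"
  shows "(\<gamma> s + \<eta> s) \<bottom>\<^sub>B (\<gamma> s - \<eta> s)"
proof -
  let ?y = "\<gamma> (r s)"
  obtain \<delta> where \<delta>: "\<delta> = 1 \<or> \<delta> = - 1" "?y = \<delta> *\<^sub>R \<eta> s" using \<gamma>_r s by blast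
  have ne: "\<gamma> s + ?y \<noteq> 0" "\<gamma> s - ?y \<noteq> 0"
    using \<delta>(1) add_diff_nonzero[of s] unfolding \<delta>(2) by (elim disjE; simp del: right_minus_eq)+
  have "((\<lambda>t. t *\<^sub>R \<gamma> s - inverse t *\<^sub>R ?y) has_vector_derivative \<gamma> s + ?y) (at 1)"
    by (rule has_vector_derivative_eq_rhs)
      (auto intro!: derivative_eq_intros simp: has_real_derivative_iff_has_vector_derivative[symmetric])
  then have "((\<lambda>t. norm (t *\<^sub>R \<gamma> s - inverse t *\<^sub>R ?y)) has_real_derivative
      D (1 *\<^sub>R \<gamma> s - inverse 1 *\<^sub>R ?y) (\<gamma> s + ?y)) (at 1)"
    by (rule norm_deriv) (use ne in simp)
  then have "D (1 *\<^sub>R \<gamma> s - inverse 1 *\<^sub>R ?y) (\<gamma> s + ?y) = 0"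
  proof (rule DERIV_local_min)
    \<comment> \<open>Radius 1 keeps \<open>t\<close> positive, which the hyperbola condition
      requires.\<close>
    show "\<forall>t. \<bar>1 - t\<bar> < 1 \<longrightarrow> norm (1 *\<^sub>R \<gamma> s - inverse 1 *\<^sub>R ?y) \<le> norm (t *\<^sub>R \<gamma> s - inverse t *\<^sub>R ?y)"
      using hyperbola[OF s] by auto
  qed simp
  then have "\<omega> (\<gamma> s + ?y) (J (\<gamma> s - ?y)) = 0" using A_pos by (simp add: D_def)
  then have "(\<gamma> s - ?y) \<bottom>\<^sub>B (\<gamma> s + ?y)" using orth_iff_\<omega>_J ne by blast
  \<comment> \<open>For \<open>\<delta> = - 1\<close> the diagonals already appear in the desired
    order; for \<open>\<delta> = 1\<close> Radon symmetry swaps them.\<close>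
  then show ?thesis using \<delta> orth_sym by auto
qed

text \<open>The area spanned by the diagonals is computed twice: by their orthogonality it is
  \<open>A\<close> times the product of the norms, by bilinearity it is
  \<open>2 * A\<close>.\<close>

lemma norm_diagonals:
  assumes s: "s \<in> {0..L}"
  shows "norm (\<gamma> s + \<eta> s) * norm (\<gamma> s - \<eta> s) = 2"
proof -
  have "A * (norm (\<gamma> s + \<eta> s) * norm (\<gamma> s - \<eta> s)) = \<bar>\<omega> (\<gamma> s + \<eta> s) (\<gamma> s - \<eta> s)\<bar>"
    using abs_\<omega>_orth[OF add_diff_nonzero diagonals_orth[OF s]] by simp
  also have "\<dots> = A * 2"
    using A_pos by (simp add: \<omega>_linear \<omega>_commute[of "\<eta> s" "\<gamma> s"] \<omega>_J)
  finally show ?thesis using A_pos by simp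
qed

text \<open>
  With \<open>\<tau> = norm (\<gamma> s + \<eta> s)\<close> and \<open>\<rho> = norm (\<gamma> s - \<eta> s)\<close> one has
  \<open>1/\<tau>\<^sup>2 + 1/\<rho>\<^sup>2 \<ge> 2/(\<tau> * \<rho>) = 1\<close>, whereas the integrals of
  \<open>(1 + \<kappa>)/\<tau>\<^sup>2\<close>, \<open>(1 + \<kappa>)/\<rho>\<^sup>2\<close>, \<open>1\<close> and \<open>\<kappa>\<close> all equal \<open>L\<close>. So equality holds everywhere.
\<close>

lemma norm_diagonal:
  assumes s: "s \<in> {0..L}"
  shows "(norm (\<gamma> s + \<eta> s))\<^sup>2 = 2"
proof -
  define \<tau> \<rho> where "\<tau> s = norm (\<gamma> s + \<eta> s)" and "\<rho> s = norm (\<gamma> s - \<eta> s)" for s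
  have pos: "0 < \<tau> s" "0 < \<rho> s" for s using add_diff_nonzero by (simp_all add: \<tau>_def \<rho>_def)
  have prod: "\<tau> s * \<rho> s = 2" if "s \<in> {0..L}" for s
    using norm_diagonals[OF that] by (simp add: \<tau>_def \<rho>_def)
  define G where "G s = (1 + \<kappa> s) / (\<tau> s)\<^sup>2 + (1 + \<kappa> s) / (\<rho> s)\<^sup>2 - (1 + \<kappa> s)" for s
  have cont: "continuous_on {0..L} \<tau>" "continuous_on {0..L} \<rho>"
    unfolding \<tau>_def \<rho>_def by (intro continuous_intros; auto)+
  have contG: "continuous_on {0..L} (\<lambda>s. (1 + \<kappa> s) / (\<tau> s)\<^sup>2)"
    "continuous_on {0..L} (\<lambda>s. (1 + \<kappa> s) / (\<rho> s)\<^sup>2)" "continuous_on {0..L} (\<lambda>s. 1 + \<kappa> s)"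
    by (intro continuous_intros cont continuous_\<kappa>; use pos in \<open>simp add: less_imp_neq[symmetric]\<close>)+
  note int = contG[THEN integrable_continuous_interval]
  have G_eq: "G s = (1 + \<kappa> s) * (1 / \<tau> s - 1 / \<rho> s)\<^sup>2" if s: "s \<in> {0..L}" for s
  proof -
    have "2 / (\<tau> s * \<rho> s) = 1" using prod[OF s] by simp
    then have "1 / (\<tau> s)\<^sup>2 + 1 / (\<rho> s)\<^sup>2 - 1 = (1 / \<tau> s - 1 / \<rho> s)\<^sup>2"
      by (simp add: power2_diff power_divide)
    moreover have "G s = (1 + \<kappa> s) * (1 / (\<tau> s)\<^sup>2 + 1 / (\<rho> s)\<^sup>2 - 1)"
      by (simp add: G_def algebra_simps)
    ultimately show ?thesis by simp
  qed
  have "integral {0..L} (\<lambda>s. 1 + \<kappa> s) = integral {0..L} (\<lambda>s. 1) + integral {0..L} \<kappa>"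
    by (intro integral_add integrable_continuous_interval continuous_\<kappa> continuous_intros)
  then have "integral {0..L} (\<lambda>s. 1 + \<kappa> s) = 2 * L" using integral_\<kappa> L_pos by simp
  moreover have "integral {0..L} G = integral {0..L} (\<lambda>s. (1 + \<kappa> s) / (\<tau> s)\<^sup>2) +
      integral {0..L} (\<lambda>s. (1 + \<kappa> s) / (\<rho> s)\<^sup>2) - integral {0..L} (\<lambda>s. 1 + \<kappa> s)"
    unfolding G_def using int by (simp add: integral_add integral_diff integrable_add)
  ultimately have "integral {0..L} G = 0"
    using integral_norm_add integral_norm_diff by (simp add: \<tau>_def \<rho>_def)
  moreover have "continuous_on {0..L} G"
    unfolding G_def by (intro continuous_on_add continuous_on_diff contG)
  ultimately have "\<forall>s\<in>{0..L}. G s = 0"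
    using integral_eq_0_iff[of 0 L G] L_pos \<kappa>_nonneg by (simp add: G_eq)
  then have "G s = 0" using s by blast
  then have "1 / \<tau> s - 1 / \<rho> s = 0" using \<kappa>_nonneg[OF s] by (simp add: G_eq[OF s])
  then have "\<tau> s = \<rho> s" by simp
  then show ?thesis using prod[OF s] by (simp add: \<tau>_def power2_eq_square)
qed

text \<open>The norm of \<open>\<gamma> s + \<eta> s\<close> is constant, so its supporting
  functional kills the velocity of that vector. Splitting the velocity along the two diagonals, the
  second part is killed by orthogonality, and what remains is a nonzero multiple of
  \<open>1 - \<kappa> s\<close>.\<close>

lemma \<kappa>_eq_1:
  assumes s: "s \<in> {0..L}"
  shows "\<kappa> s = 1"
proof -
  let ?w = "\<gamma> s + \<eta> s" and ?z = "\<gamma> s - \<eta> s"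
  have "((\<lambda>s. \<gamma> s + \<eta> s) has_vector_derivative (\<epsilon> *\<^sub>R \<eta> s + - (\<epsilon> * \<kappa> s) *\<^sub>R \<gamma> s)) (at s within {0..L})"
    by (intro has_vector_derivative_add \<gamma>_deriv_within \<eta>_deriv[OF s])
  from norm_deriv[OF this add_diff_nonzero(1)]
  have 1: "((\<lambda>s. norm (\<gamma> s + \<eta> s)) has_real_derivative
      D ?w (\<epsilon> *\<^sub>R \<eta> s + - (\<epsilon> * \<kappa> s) *\<^sub>R \<gamma> s)) (at s within {0..L})" .
  have "((\<lambda>s. sqrt 2) has_real_derivative 0) (at s within {0..L})" by simp
  then have 2: "((\<lambda>s. norm (\<gamma> s + \<eta> s)) has_real_derivative 0) (at s within {0..L})"
    unfolding has_real_derivative_iff_has_vector_derivative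
  proof (rule has_vector_derivative_transform[OF s, rotated])
    fix t assume "t \<in> {0..L}"
    then show "norm (\<gamma> t + \<eta> t) = sqrt 2"
      using norm_diagonal[of t] by (metis norm_ge_zero real_sqrt_unique)
  qed
  have "D ?w (\<epsilon> *\<^sub>R \<eta> s + - (\<epsilon> * \<kappa> s) *\<^sub>R \<gamma> s) = 0"
    using vector_derivative_unique_within_closed_interval[of 0 L s] 1 2 s L_pos
    by (simp add: has_real_derivative_iff_has_vector_derivative)
  also have "\<epsilon> *\<^sub>R \<eta> s + - (\<epsilon> * \<kappa> s) *\<^sub>R \<gamma> s = \<epsilon> *\<^sub>R (((1 - \<kappa> s) / 2) *\<^sub>R ?w - ((1 + \<kappa> s) / 2) *\<^sub>R ?z)"
    by (rule co_eqI) (simp_all add: field_simps)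
  finally have "\<epsilon> * ((1 - \<kappa> s) / 2 * D ?w ?w - (1 + \<kappa> s) / 2 * D ?w ?z) = 0"
    by (simp only: D_linear)
  moreover have "D ?w ?z = 0"
    using diagonals_orth[OF s] orth_iff_\<omega>_J[OF add_diff_nonzero] by (simp add: D_def)
  ultimately show ?thesis using add_diff_nonzero[of s] \<epsilon>_cases by (auto simp: D_self)
qed

text \<open>Now \<open>\<gamma>\<close> and \<open>\<eta>\<close> solve the linear system of a
  uniform rotation. Rotating the frame back by \<open>s\<close> gives \<open>u\<close> and
  \<open>v\<close> with zero derivative, and rotating forward again recovers
  \<open>\<gamma> s\<close>.\<close>

lemma \<gamma>_eq_cos_sin:
  assumes s: "s \<in> {0..L}"
  shows "\<gamma> s = cos s *\<^sub>R \<gamma> 0 + sin s *\<^sub>R \<epsilon> *\<^sub>R \<eta> 0"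
proof -
  define u v where "u s = cos s *\<^sub>R \<gamma> s - (\<epsilon> * sin s) *\<^sub>R \<eta> s" and
    "v s = sin s *\<^sub>R \<gamma> s + (\<epsilon> * cos s) *\<^sub>R \<eta> s" for s
  have const: "f s = f 0" if "\<And>s. s \<in> {0..L} \<Longrightarrow> (f has_vector_derivative 0) (at s within {0..L})"
    for f :: "real \<Rightarrow> 'a"
  proof -
    have "\<exists>c. \<forall>s\<in>{0..L}. f s = c"
      using that by (intro has_derivative_zero_constant) (auto simp: has_vector_derivative_def)
    then show ?thesis using s L_pos by force
  qed
  have \<eta>': "(\<eta> has_vector_derivative - \<epsilon> *\<^sub>R \<gamma> s) (at s within {0..L})" if "s \<in> {0..L}" for s
    using \<eta>_deriv[OF that] \<kappa>_eq_1[OF that] by simp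
  have "u s = u 0"
  proof (rule const)
    fix s assume s: "s \<in> {0..L}"
    have c: "(cos has_real_derivative - sin s) (at s within {0..L})"
      "((\<lambda>s. \<epsilon> * sin s) has_real_derivative \<epsilon> * cos s) (at s within {0..L})"
      by (auto intro!: derivative_eq_intros)
    show "(u has_vector_derivative 0) (at s within {0..L})"
      unfolding u_def[abs_def]
      by (rule has_vector_derivative_eq_rhs, rule has_vector_derivative_diff,
          rule has_vector_derivative_scaleR[OF c(1) \<gamma>_deriv_within],
          rule has_vector_derivative_scaleR[OF c(2) \<eta>'[OF s]])
        (simp add: mult_ac)
  qed
  moreover have "v s = v 0"
  proof (rule const)
    fix s assume s: "s \<in> {0..L}"
    have c: "(sin has_real_derivative cos s) (at s within {0..L})"
      "((\<lambda>s. \<epsilon> * cos s) has_real_derivative - \<epsilon> * sin s) (at s within {0..L})"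
      by (auto intro!: derivative_eq_intros)
    show "(v has_vector_derivative 0) (at s within {0..L})"
      unfolding v_def[abs_def]
      by (rule has_vector_derivative_eq_rhs, rule has_vector_derivative_add,
          rule has_vector_derivative_scaleR[OF c(1) \<gamma>_deriv_within],
          rule has_vector_derivative_scaleR[OF c(2) \<eta>'[OF s]])
        (simp add: mult_ac)
  qed
  moreover have "\<gamma> s = cos s *\<^sub>R u s + sin s *\<^sub>R v s"
  proof -
    have "cos s *\<^sub>R u s + sin s *\<^sub>R v s = (cos s * cos s) *\<^sub>R \<gamma> s + (sin s * sin s) *\<^sub>R \<gamma> s"
      by (simp add: u_def v_def scaleR_add_right scaleR_diff_right mult_ac)
    also have "\<dots> = ((cos s)\<^sup>2 + (sin s)\<^sup>2) *\<^sub>R \<gamma> s"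
      by (simp only: scaleR_add_left power2_eq_square)
    finally show ?thesis by simp
  qed
  ultimately have "\<gamma> s = cos s *\<^sub>R u 0 + sin s *\<^sub>R v 0" by (simp only:)
  moreover have "u 0 = \<gamma> 0" "v 0 = \<epsilon> *\<^sub>R \<eta> 0" by (simp_all add: u_def v_def)
  ultimately show ?thesis by (simp only:)
qed

text \<open>A normalized vector is some \<open>\<gamma> s\<close>, whose frame coordinates are
  \<open>cos s\<close> and \<open>sin s\<close>; comparing coordinates and squaring gives the
  norm.\<close>

lemma norm_frame:
  "norm (a *\<^sub>R \<gamma> 0 + b *\<^sub>R \<epsilon> *\<^sub>R \<eta> 0) = sqrt (a\<^sup>2 + b\<^sup>2)"
proof -
  let ?x = "a *\<^sub>R \<gamma> 0 + b *\<^sub>R \<epsilon> *\<^sub>R \<eta> 0"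
  have pos: "0 < \<omega> (\<gamma> 0) (\<eta> 0)" by (simp add: \<omega>_J_pos)
  have unique: "c = a \<and> d = b"
    if eq: "c *\<^sub>R \<gamma> 0 + d *\<^sub>R \<epsilon> *\<^sub>R \<eta> 0 = a *\<^sub>R \<gamma> 0 + b *\<^sub>R \<epsilon> *\<^sub>R \<eta> 0" for a b c d
    using arg_cong[OF eq, of "\<lambda>x. \<omega> x (\<eta> 0)"] arg_cong[OF eq, of "\<omega> (\<gamma> 0)"] pos \<epsilon>_cases
    by (auto simp: \<omega>_linear)
  show ?thesis
  proof (cases "?x = 0")
    case True
    then have "a = 0 \<and> b = 0" using unique[of 0 0 a b] by auto
    then show ?thesis by simp
  next
    case False
    then obtain s where s: "s \<in> {0..L}" "\<gamma> s = ?x /\<^sub>R norm ?x"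
      using \<gamma>_surj[of "?x /\<^sub>R norm ?x"] by auto
    then have "?x = norm ?x *\<^sub>R \<gamma> s" using False by simp
    also have "\<dots> = (norm ?x * cos s) *\<^sub>R \<gamma> 0 + (norm ?x * sin s) *\<^sub>R \<epsilon> *\<^sub>R \<eta> 0"
      by (subst \<gamma>_eq_cos_sin[OF s(1)]) (simp add: scaleR_add_right)
    finally have "a = norm ?x * cos s \<and> b = norm ?x * sin s" by (rule unique)
    then have "a\<^sup>2 + b\<^sup>2 = (norm ?x)\<^sup>2 * ((cos s)\<^sup>2 + (sin s)\<^sup>2)"
      by (metis distrib_left power_mult_distrib)
    then show ?thesis by simp
  qed
qed

lemma frame_span: "\<exists>a b. x = a *\<^sub>R \<gamma> 0 + b *\<^sub>R \<epsilon> *\<^sub>R \<eta> 0"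
proof -
  have "\<omega> (\<gamma> 0) (\<eta> 0) \<noteq> 0" using \<omega>_J_pos[of "\<gamma> 0"] by simp
  then obtain a b where "x = a *\<^sub>R \<gamma> 0 + b *\<^sub>R \<eta> 0" using cramer_div by blast
  moreover have "b *\<^sub>R \<eta> 0 = (\<epsilon> * b) *\<^sub>R \<epsilon> *\<^sub>R \<eta> 0" using \<epsilon>_cases by auto
  ultimately have "x = a *\<^sub>R \<gamma> 0 + (\<epsilon> * b) *\<^sub>R \<epsilon> *\<^sub>R \<eta> 0" by simp
  then show ?thesis by blast
qed

end

section \<open>Affine curvature of an ellipse\<close>

locale orthonormal_frame =
  fixes f\<^sub>1 f\<^sub>2 :: "'a::real_normed_vector"
  assumes span: "\<exists>a b. x = a *\<^sub>R f\<^sub>1 + b *\<^sub>R f\<^sub>2"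
    and norm_combination: "norm (a *\<^sub>R f\<^sub>1 + b *\<^sub>R f\<^sub>2) = sqrt (a\<^sup>2 + b\<^sup>2)"
begin

section \<open>The inner product by polarization\<close>

definition B :: "'a \<Rightarrow> 'a \<Rightarrow> real" where
  "B x y = ((norm (x + y))\<^sup>2 - (norm x)\<^sup>2 - (norm y)\<^sup>2) / 2"

lemma B_combination [simp]:
  "B (a *\<^sub>R f\<^sub>1 + b *\<^sub>R f\<^sub>2) (c *\<^sub>R f\<^sub>1 + d *\<^sub>R f\<^sub>2) = a * c + b * d"
proof -
  have "(a *\<^sub>R f\<^sub>1 + b *\<^sub>R f\<^sub>2) + (c *\<^sub>R f\<^sub>1 + d *\<^sub>R f\<^sub>2) = (a + c) *\<^sub>R f\<^sub>1 + (b + d) *\<^sub>R f\<^sub>2"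
    by (simp add: algebra_simps)
  then have "B (a *\<^sub>R f\<^sub>1 + b *\<^sub>R f\<^sub>2) (c *\<^sub>R f\<^sub>1 + d *\<^sub>R f\<^sub>2) =
      ((a + c)\<^sup>2 + (b + d)\<^sup>2 - (a\<^sup>2 + b\<^sup>2) - (c\<^sup>2 + d\<^sup>2)) / 2"
    by (simp add: B_def norm_combination)
  then show ?thesis by (simp add: power2_sum)
qed

lemma B_commute: "B x y = B y x"
  by (simp add: B_def add.commute)

lemma B_self: "B x x = (norm x)\<^sup>2"
  by (simp add: B_def flip: scaleR_2)

lemma B_add: "B (x + y) z = B x z + B y z"
proof -
  obtain a b where x: "x = a *\<^sub>R f\<^sub>1 + b *\<^sub>R f\<^sub>2" using span by blast
  obtain c d where y: "y = c *\<^sub>R f\<^sub>1 + d *\<^sub>R f\<^sub>2" using span by blast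
  obtain p q where z: "z = p *\<^sub>R f\<^sub>1 + q *\<^sub>R f\<^sub>2" using span by blast
  have xy: "x + y = (a + c) *\<^sub>R f\<^sub>1 + (b + d) *\<^sub>R f\<^sub>2" by (simp add: x y algebra_simps)
  show ?thesis unfolding xy unfolding x y z B_combination by (simp add: algebra_simps)
qed

lemma B_scaleR: "B (k *\<^sub>R x) z = k * B x z"
proof -
  obtain a b where x: "x = a *\<^sub>R f\<^sub>1 + b *\<^sub>R f\<^sub>2" using span by blast
  obtain p q where z: "z = p *\<^sub>R f\<^sub>1 + q *\<^sub>R f\<^sub>2" using span by blast
  have kx: "k *\<^sub>R x = (k * a) *\<^sub>R f\<^sub>1 + (k * b) *\<^sub>R f\<^sub>2" by (simp add: x algebra_simps)
  show ?thesis unfolding kx unfolding x z B_combination by (simp add: algebra_simps)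
qed

text \<open>The bound is the Cauchy-Schwarz inequality, here the squared triangle inequality;
  applying it to \<open>- x\<close> as well controls the absolute value.\<close>

lemma bounded_bilinear_B: "bounded_bilinear B"
proof
  show "\<exists>K. \<forall>x y. norm (B x y) \<le> norm x * norm y * K"
  proof (intro exI allI)
    fix x y :: 'a
    have "B (- 1 *\<^sub>R x) y = - 1 * B x y" by (rule B_scaleR)
    moreover have "B x y \<le> norm x * norm y" for x y
      using power_mono[OF norm_triangle_ineq[of x y] norm_ge_zero, of 2] by (simp add: B_def power2_sum)
    from this[of x y] this[of "- 1 *\<^sub>R x" y] have "B x y \<le> norm x * norm y" "B (- 1 *\<^sub>R x) y \<le> norm x * norm y"
      by simp_all
    ultimately show "norm (B x y) \<le> norm x * norm y * 1" by simp
  qed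
qed (use B_add B_scaleR B_commute in \<open>metis real_scaleR_def\<close>)+

lemmas B_linear = bounded_bilinear.add_left[OF bounded_bilinear_B]
  bounded_bilinear.add_right[OF bounded_bilinear_B]
  bounded_bilinear.scaleR_left[OF bounded_bilinear_B]
  bounded_bilinear.scaleR_right[OF bounded_bilinear_B]
  bounded_bilinear.diff_left[OF bounded_bilinear_B]
  bounded_bilinear.diff_right[OF bounded_bilinear_B]
  bounded_bilinear.minus_left[OF bounded_bilinear_B]
  bounded_bilinear.minus_right[OF bounded_bilinear_B]

lemma frame_norm_from_inner_product: "norm_from_inner_product TYPE('a)"
  unfolding norm_from_inner_product_def
proof (intro exI[of _ B] conjI allI impI)
  show "bilinear B"
    by (auto simp: bilinear_def linear_iff B_linear)
  show "B x y = B y x" for x y by (rule B_commute)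
  show "0 < B x x" if "x \<noteq> 0" for x using that by (simp add: B_self)
  show "norm x = sqrt (B x x)" for x by (simp add: B_self)
qed

lemma B_frame [simp]: "B f\<^sub>1 f\<^sub>1 = 1" "B f\<^sub>2 f\<^sub>2 = 1" "B f\<^sub>1 f\<^sub>2 = 0" "B f\<^sub>2 f\<^sub>1 = 0"
  using B_combination[of 1 0 1 0] B_combination[of 0 1 0 1] B_combination[of 1 0 0 1]
    B_combination[of 0 1 1 0] by simp_all

lemma expand: "x = B x f\<^sub>1 *\<^sub>R f\<^sub>1 + B x f\<^sub>2 *\<^sub>R f\<^sub>2"
proof -
  obtain a b where x: "x = a *\<^sub>R f\<^sub>1 + b *\<^sub>R f\<^sub>2" using span by blast
  show ?thesis unfolding x by (simp add: B_linear)
qed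

lemma eqI: "B x f\<^sub>1 = B y f\<^sub>1 \<Longrightarrow> B x f\<^sub>2 = B y f\<^sub>2 \<Longrightarrow> x = y"
  using expand[of x] expand[of y] by simp

lemma B_expand: "B x y = B x f\<^sub>1 * B y f\<^sub>1 + B x f\<^sub>2 * B y f\<^sub>2"
  by (subst expand[of x], subst expand[of y], subst B_combination) simp

section \<open>Rotation and area forms\<close>

definition rot :: "'a \<Rightarrow> 'a" where
  "rot x = (- B x f\<^sub>2) *\<^sub>R f\<^sub>1 + B x f\<^sub>1 *\<^sub>R f\<^sub>2"

lemma B_rot [simp]: "B (rot x) f\<^sub>1 = - B x f\<^sub>2" "B (rot x) f\<^sub>2 = B x f\<^sub>1"
  by (simp_all add: rot_def B_linear)

lemma bounded_linear_rot: "bounded_linear rot"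
  unfolding rot_def
  by (intro bounded_linear_add bounded_linear_minus bounded_linear_scaleR_const
      bounded_bilinear.bounded_linear_left[OF bounded_bilinear_B])

lemma rot_scaleR: "rot (k *\<^sub>R x) = k *\<^sub>R rot x"
  by (rule eqI) (simp_all add: B_linear)

lemma rot_rot: "rot (rot x) = - 1 *\<^sub>R x"
  by (rule eqI) (simp_all only: B_rot B_linear, simp_all)

lemma rot_expand:
  assumes "B x x = 1"
  shows "y = B x y *\<^sub>R x + B (rot x) y *\<^sub>R rot x"
proof -
  have x: "B x f\<^sub>1 * B x f\<^sub>1 + B x f\<^sub>2 * B x f\<^sub>2 = 1" using assms B_expand[of x x] by simp
  show ?thesis
  proof (rule eqI)
    have "B (B x y *\<^sub>R x + B (rot x) y *\<^sub>R rot x) f\<^sub>1 =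
      (B x f\<^sub>1 * B x f\<^sub>1 + B x f\<^sub>2 * B x f\<^sub>2) * B y f\<^sub>1"
      by (simp add: B_linear B_expand[of x y] B_expand[of "rot x" y] algebra_simps)
    then show "B y f\<^sub>1 = B (B x y *\<^sub>R x + B (rot x) y *\<^sub>R rot x) f\<^sub>1" by (simp add: x)
    have "B (B x y *\<^sub>R x + B (rot x) y *\<^sub>R rot x) f\<^sub>2 =
      (B x f\<^sub>1 * B x f\<^sub>1 + B x f\<^sub>2 * B x f\<^sub>2) * B y f\<^sub>2"
      by (simp add: B_linear B_expand[of x y] B_expand[of "rot x" y] algebra_simps)
    then show "B y f\<^sub>2 = B (B x y *\<^sub>R x + B (rot x) y *\<^sub>R rot x) f\<^sub>2" by (simp add: x)
  qed
qed

text \<open>In a plane an alternating form is determined by its value on one basis, and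
  \<open>B (rot x) y\<close> is the determinant in the orthonormal frame. Expanding the square of
  \<open>f\<^sub>1 + f\<^sub>2\<close> gives the antisymmetry used.\<close>

lemma area_form_eq:
  assumes "area_form w"
  shows "w x y = w f\<^sub>1 f\<^sub>2 * B (rot x) y"
proof -
  have bil: "bilinear w" and alt: "\<And>x. w x x = 0" using assms by (auto simp: area_form_def)
  note lin = bilinear_ladd[OF bil] bilinear_radd[OF bil] bilinear_lmul[OF bil] bilinear_rmul[OF bil]
  have "w f\<^sub>1 f\<^sub>1 + w f\<^sub>1 f\<^sub>2 + (w f\<^sub>2 f\<^sub>1 + w f\<^sub>2 f\<^sub>2) = w (f\<^sub>1 + f\<^sub>2) (f\<^sub>1 + f\<^sub>2)"
    by (simp only: lin add_ac)
  then have "w f\<^sub>2 f\<^sub>1 = - w f\<^sub>1 f\<^sub>2" unfolding alt by simp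
  then show ?thesis
    by (subst expand[of x], subst expand[of y])
      (simp add: lin alt B_expand[of "rot x" y] algebra_simps)
qed

section \<open>The circle in affine arc length\<close>

lemma nth_deriv_eqs: "nth_deriv 0 c = c"
  "nth_deriv 1 c = (\<lambda>s. vector_derivative c (at s))"
  "nth_deriv 2 c = (\<lambda>s. vector_derivative (nth_deriv 1 c) (at s))"
  "nth_deriv 3 c = (\<lambda>s. vector_derivative (nth_deriv 2 c) (at s))"
  by (simp_all add: nth_deriv_def numeral_2_eq_2 numeral_3_eq_3)

lemma nth_deriv_circle:
  fixes k :: real
  defines "c \<equiv> \<lambda>s. cos (k * s) *\<^sub>R f\<^sub>1 + sin (k * s) *\<^sub>R f\<^sub>2"
  shows "(nth_deriv 0 c has_vector_derivative k *\<^sub>R rot (c s)) (at s)"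
    and "nth_deriv 1 c = (\<lambda>s. k *\<^sub>R rot (c s))"
    and "(nth_deriv 1 c has_vector_derivative (- k\<^sup>2) *\<^sub>R c s) (at s)"
    and "nth_deriv 2 c = (\<lambda>s. (- k\<^sup>2) *\<^sub>R c s)"
    and "(nth_deriv 2 c has_vector_derivative (- (k ^ 3)) *\<^sub>R rot (c s)) (at s)"
    and "nth_deriv 3 c = (\<lambda>s. (- (k ^ 3)) *\<^sub>R rot (c s))"
proof -
  have c': "(c has_vector_derivative k *\<^sub>R rot (c s)) (at s)" for s
  proof -
    have 1: "((\<lambda>s. cos (k * s)) has_real_derivative - k * sin (k * s)) (at s)"
      and 2: "((\<lambda>s. sin (k * s)) has_real_derivative k * cos (k * s)) (at s)"
      by (auto intro!: derivative_eq_intros)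
    show ?thesis
      unfolding c_def
      by (rule has_vector_derivative_eq_rhs, rule has_vector_derivative_add,
          rule has_vector_derivative_scaleR[OF 1 has_vector_derivative_const],
          rule has_vector_derivative_scaleR[OF 2 has_vector_derivative_const])
        (simp add: rot_def B_linear scaleR_add_right scaleR_diff_right)
  qed
  show d0: "(nth_deriv 0 c has_vector_derivative k *\<^sub>R rot (c s)) (at s)" for s
    unfolding nth_deriv_eqs(1) by (rule c')
  show n1: "nth_deriv 1 c = (\<lambda>s. k *\<^sub>R rot (c s))"
    unfolding nth_deriv_eqs(2) by (rule ext, rule vector_derivative_at, rule c')
  have rc: "((\<lambda>s. rot (c s)) has_vector_derivative - k *\<^sub>R c s) (at s)" for s
    using bounded_linear.has_vector_derivative[OF bounded_linear_rot c'[of s]]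
    by (simp add: rot_scaleR rot_rot)
  show d1: "(nth_deriv 1 c has_vector_derivative (- k\<^sup>2) *\<^sub>R c s) (at s)" for s
    using bounded_linear.has_vector_derivative[OF bounded_linear_scaleR_right[of k] rc[of s]]
    unfolding n1 by (simp add: power2_eq_square)
  show n2: "nth_deriv 2 c = (\<lambda>s. (- k\<^sup>2) *\<^sub>R c s)"
    unfolding nth_deriv_eqs(3) by (rule ext, rule vector_derivative_at, rule d1)
  show d2: "(nth_deriv 2 c has_vector_derivative (- (k ^ 3)) *\<^sub>R rot (c s)) (at s)" for s
    using bounded_linear.has_vector_derivative[OF bounded_linear_scaleR_right[of "- k\<^sup>2"] c'[of s]]
    unfolding n2 by (simp add: power2_eq_square power3_eq_cube)
  show "nth_deriv 3 c = (\<lambda>s. (- (k ^ 3)) *\<^sub>R rot (c s))"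
    unfolding nth_deriv_eqs(4) by (rule ext, rule vector_derivative_at, rule d2)
qed

text \<open>The first derivative contributes a factor \<open>k\<close> and the second
  \<open>k\<^sup>2\<close>, whence the cubic condition on \<open>k\<close>. For negative
  \<open>w f\<^sub>1 f\<^sub>2\<close> the speed \<open>k\<close> is negative and the circle is
  traversed backwards.\<close>

lemma circle_affine_arclength:
  assumes w: "area_form w" and k: "k ^ 3 * w f\<^sub>1 f\<^sub>2 = 1"
  shows "affine_arclength_param w (sphere 0 1) (\<lambda>s. cos (k * s) *\<^sub>R f\<^sub>1 + sin (k * s) *\<^sub>R f\<^sub>2)"
    (is "affine_arclength_param w _ ?c")
  unfolding affine_arclength_param_def
proof (intro conjI allI impI)
  note d = nth_deriv_circle[of k]
  have B1: "B (?c s) (?c s) = 1" for s by (simp flip: power2_eq_square)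
  show "nth_deriv n ?c differentiable at s" if "n < 3" for n s
  proof -
    have "n = 0 \<or> n = 1 \<or> n = 2" using that by linarith
    then show ?thesis
      using d(1,3,5)[THEN differentiableI_vector] by auto
  qed
  show "continuous_on UNIV (nth_deriv 3 ?c)"
    unfolding d(6) by (intro continuous_intros bounded_linear.continuous_on[OF bounded_linear_rot])
  have w_eq: "w (k *\<^sub>R rot x) ((- k\<^sup>2) *\<^sub>R x) = k ^ 3 * w f\<^sub>1 f\<^sub>2 * B x x" for x
    unfolding area_form_eq[OF w, of "k *\<^sub>R rot x"]
    by (simp add: rot_scaleR rot_rot B_linear power2_eq_square power3_eq_cube)
  show "w (nth_deriv 1 ?c s) (nth_deriv 2 ?c s) = 1" for s
    unfolding d(2,4) w_eq B1 k by simp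
  show "range ?c = sphere 0 1"
  proof
    show "range ?c \<subseteq> sphere 0 1" by (auto simp: norm_combination)
    show "sphere 0 1 \<subseteq> range ?c"
    proof
      fix x :: 'a assume x: "x \<in> sphere 0 1"
      obtain a b where ab: "x = a *\<^sub>R f\<^sub>1 + b *\<^sub>R f\<^sub>2" using span by blast
      with x have "a\<^sup>2 + b\<^sup>2 = 1" by (simp add: norm_combination)
      then obtain t where t: "a = cos t" "b = sin t" using sincos_total_2pi by metis
      have "k \<noteq> 0" using k by auto
      then have "?c (t / k) = x" by (simp add: ab t)
      then show "x \<in> range ?c" by blast
    qed
  qed
qed

text \<open>The parametrization is arbitrary, so it must first be pinned down. Differentiating
  \<open>B (c s) (c s) = 1\<close> twice makes the velocity a multiple \<open>m\<close> of
  \<open>rot (c s)\<close>; affine arc length then gives \<open>m\<close> the same cubic equation as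
  \<open>k\<close>, and real cubing is injective.\<close>

lemma affine_curvature_circle:
  assumes w: "area_form w" and k: "k ^ 3 * w f\<^sub>1 f\<^sub>2 = 1"
    and c: "affine_arclength_param w (sphere 0 1) c"
  shows "affine_curvature w c s = k\<^sup>2"
proof -
  let ?W = "w f\<^sub>1 f\<^sub>2"
  define c1 c2 where "c1 = nth_deriv 1 c" and "c2 = nth_deriv 2 c"
  have diff: "nth_deriv n c differentiable at s" if "n < 3" for n s
    using c that by (simp add: affine_arclength_param_def)
  have d0: "(c has_vector_derivative c1 s) (at s)" for s
    using vector_derivative_works[THEN iffD1, OF diff[of 0 s]]
    unfolding c1_def nth_deriv_eqs(1,2) by simp
  have d1: "(c1 has_vector_derivative c2 s) (at s)" for s
    using vector_derivative_works[THEN iffD1, OF diff[of 1 s]]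
    unfolding c1_def c2_def nth_deriv_eqs(3) by simp
  have unit: "B (c s) (c s) = 1" for s
  proof -
    have "c s \<in> sphere 0 1" using c unfolding affine_arclength_param_def by blast
    then show ?thesis by (simp add: B_self)
  qed
  have const: "z = 0" if "(f has_vector_derivative z) (at s)" "\<And>s. f s = a" for f :: "real \<Rightarrow> real" and z a s
  proof -
    have "f = (\<lambda>s. a)" using that(2) by auto
    then show ?thesis using that(1) vector_derivative_at by fastforce
  qed
  have tangent: "B (c s) (c1 s) = 0" for s
  proof -
    have "B (c s) (c1 s) + B (c1 s) (c s) = 0"
      by (rule const[OF bounded_bilinear.has_vector_derivative[OF bounded_bilinear_B d0 d0] unit])
    then show ?thesis by (simp add: B_commute[of "c1 s" "c s"])
  qed
  have second: "B (c s) (c2 s) = - B (c1 s) (c1 s)" for s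
  proof -
    have "B (c s) (c2 s) + B (c1 s) (c1 s) = 0"
      by (rule const[OF bounded_bilinear.has_vector_derivative[OF bounded_bilinear_B d0 d1] tangent])
    then show ?thesis by simp
  qed
  have c1: "c1 s = k *\<^sub>R rot (c s)" for s
  proof -
    define m where "m = B (rot (c s)) (c1 s)"
    have cm: "c1 s = m *\<^sub>R rot (c s)"
      using rot_expand[OF unit, of "c1 s" s] by (simp add: tangent m_def)
    have "B (rot (c s)) (rot (c s)) = 1"
      using unit[of s] B_expand[of "c s" "c s"] by (simp add: B_expand[of "rot (c s)" "rot (c s)"])
    then have "B (c1 s) (c1 s) = m\<^sup>2" by (simp add: cm B_linear power2_eq_square)
    \<comment> \<open>As \<open>c1 s\<close> is tangential, only the radial part of
      \<open>c2 s\<close> counts here, and \<open>second\<close> determines it.\<close>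
    moreover have "w (c1 s) (c2 s) = ?W * (m * - B (c s) (c2 s))"
      unfolding area_form_eq[OF w, of "c1 s" "c2 s"] by (simp add: cm rot_scaleR rot_rot B_linear)
    moreover have "w (c1 s) (c2 s) = 1"
      using c by (simp add: affine_arclength_param_def c1_def c2_def)
    ultimately have "?W * (m * m\<^sup>2) = 1" by (simp add: second)
    then have "m ^ 3 * ?W = 1" by (simp add: power2_eq_square power3_eq_cube mult_ac)
    then have "m ^ 3 * ?W = k ^ 3 * ?W" using k by simp
    moreover have "?W \<noteq> 0" using k by auto
    ultimately have "m ^ 3 = k ^ 3" by simp
    then have "m = k" by (metis odd_real_root_power_cancel odd_numeral)
    then show ?thesis using cm by simp
  qed
  have rc: "((\<lambda>s. k *\<^sub>R rot (c s)) has_vector_derivative k *\<^sub>R rot (c1 s)) (at s)" for s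
    by (rule bounded_linear.has_vector_derivative[OF bounded_linear_scaleR_right
          bounded_linear.has_vector_derivative[OF bounded_linear_rot d0]])
  have "c1 = (\<lambda>s. k *\<^sub>R rot (c s))" using c1 by auto
  then have c2: "c2 s = (- k\<^sup>2) *\<^sub>R c s" for s
    using vector_derivative_at[OF rc[of s]] vector_derivative_at[OF d1[of s]]
    by (simp add: c1 rot_scaleR rot_rot power2_eq_square)
  have "((\<lambda>s. (- k\<^sup>2) *\<^sub>R c s) has_vector_derivative (- k\<^sup>2) *\<^sub>R c1 s) (at s)"
    by (rule bounded_linear.has_vector_derivative[OF bounded_linear_scaleR_right d0])
  moreover have "c2 = (\<lambda>s. (- k\<^sup>2) *\<^sub>R c s)" using c2 by auto
  ultimately have "vector_derivative c2 (at s) = (- k\<^sup>2) *\<^sub>R c1 s" by (metis vector_derivative_at)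
  then have "affine_curvature w c s = w ((- k\<^sup>2) *\<^sub>R c s) ((- k\<^sup>2) *\<^sub>R c1 s)"
    unfolding affine_curvature_def nth_deriv_eqs(4) c2_def[symmetric] by (simp only: c2)
  also have "\<dots> = k\<^sup>2 * k\<^sup>2 * w (c s) (c1 s)"
    unfolding area_form_eq[OF w, of "(- k\<^sup>2) *\<^sub>R c s"] area_form_eq[OF w, of "c s"]
      rot_scaleR bounded_bilinear.scaleR_left[OF bounded_bilinear_B]
      bounded_bilinear.scaleR_right[OF bounded_bilinear_B]
    by simp
  also have "w (c s) (c1 s) = k * ?W"
    using unit[of s] B_expand[of "c s" "c s"]
    by (simp add: area_form_eq[OF w, of "c s"] c1 B_linear B_expand[of "rot (c s)" "rot (c s)"])
  also have "k\<^sup>2 * k\<^sup>2 * (k * ?W) = (k ^ 3 * ?W) * k\<^sup>2"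
    by (simp add: power2_eq_square power3_eq_cube)
  finally show ?thesis by (simp add: k)
qed

lemma frame_has_constant_affine_curvature: "has_constant_affine_curvature (sphere (0 :: 'a) 1)"
  unfolding has_constant_affine_curvature_def
proof (intro allI impI)
  fix w :: "'a \<Rightarrow> 'a \<Rightarrow> real" assume w: "area_form w"
  then obtain x y where "w x y \<noteq> 0" unfolding area_form_def by blast
  then have "w f\<^sub>1 f\<^sub>2 \<noteq> 0" using area_form_eq[OF w, of x y] by auto
  \<comment> \<open>The odd root also serves a negatively oriented frame.\<close>
  moreover have "root 3 (1 / w f\<^sub>1 f\<^sub>2) ^ 3 = 1 / w f\<^sub>1 f\<^sub>2" by (simp add: odd_real_root_pow)
  ultimately have "root 3 (1 / w f\<^sub>1 f\<^sub>2) ^ 3 * w f\<^sub>1 f\<^sub>2 = 1" by simp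
  then show "(\<exists>c. affine_arclength_param w (sphere 0 1) c) \<and>
    (\<exists>k. \<forall>c. affine_arclength_param w (sphere 0 1) c \<longrightarrow> (\<forall>s. affine_curvature w c s = k))"
    using circle_affine_arclength[OF w] affine_curvature_circle[OF w] by blast
qed

end

section \<open>Main theorem\<close>

context radon_circle
begin

text \<open>For \<open>x = t *\<^sub>R \<gamma> s\<close> and \<open>y = \<gamma> (r s)\<close> the
  numerator does not depend on \<open>t\<close>, and the denominator is the norm along the
  hyperbola; the quotient is bounded by the supremum 1.\<close>

lemma alpha_le_beta:
  assumes DR: "DR_B TYPE('a) = 1" and s: "s \<in> {0..L}" and t: "0 < t"
  shows "norm (\<gamma> s - \<gamma> (r s)) \<le> norm (t *\<^sub>R \<gamma> s - inverse t *\<^sub>R \<gamma> (r s))"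
proof -
  let ?Q = "{alpha_dist x y / beta_dist x y | x y :: 'a.
    x \<noteq> 0 \<and> y \<noteq> 0 \<and> x \<bottom>\<^sub>B y \<and> beta_dist x y \<noteq> 0}"
  \<comment> \<open>A real \<open>Sup\<close> is an upper bound only for a set bounded above.
    Orthogonality in both directions bounds \<open>beta_dist\<close> below by
    \<open>norm x / norm y\<close> and by its reciprocal, one of which is at least 1.\<close>
  have "alpha_dist x y / beta_dist x y \<le> 2"
    if xy: "x \<noteq> 0" "y \<noteq> 0" "x \<bottom>\<^sub>B y" "beta_dist x y \<noteq> 0" for x y :: 'a
  proof -
    have "norm x / norm y \<le> beta_dist x y"
      using birkhoff_orth_bound[OF xy(3), of "inverse (norm y)" "- inverse (norm x)"]
      by (simp add: beta_dist_def divide_inverse mult.commute)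
    moreover have "norm y / norm x \<le> beta_dist x y"
      using birkhoff_orth_bound[OF orth_sym[OF xy(3)], of "- inverse (norm x)" "inverse (norm y)"]
      by (simp add: beta_dist_def divide_inverse mult.commute)
    moreover have "1 \<le> norm x / norm y \<or> 1 \<le> norm y / norm x"
      using xy by (simp add: le_divide_eq) linarith
    ultimately have beta: "1 \<le> beta_dist x y" by linarith
    have "alpha_dist x y \<le> norm (x /\<^sub>R norm x) + norm (y /\<^sub>R norm y)"
      unfolding alpha_dist_def by (rule norm_triangle_ineq4)
    also have "\<dots> = 2" using xy by simp
    finally show ?thesis using beta by (simp add: divide_le_eq)
  qed
  then have bdd: "bdd_above ?Q" by (intro bdd_aboveI[of _ 2]) blast
  let ?x = "t *\<^sub>R \<gamma> s" and ?y = "\<gamma> (r s)"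
  have orth: "\<gamma> s \<bottom>\<^sub>B ?y" using s birkhoff by (simp add: birkhoff_param_def)
  have alpha: "alpha_dist ?x ?y = norm (\<gamma> s - ?y)" using t by (simp add: alpha_dist_def)
  have beta: "beta_dist ?x ?y = norm (t *\<^sub>R \<gamma> s - inverse t *\<^sub>R ?y)" using t by (simp add: beta_dist_def)
  have "t \<le> beta_dist ?x ?y"
    using birkhoff_orth_bound[OF orth, of t "- inverse t"] t by (simp add: beta)
  then have pos: "0 < beta_dist ?x ?y" using t by linarith
  have "?x \<bottom>\<^sub>B ?y" using birkhoff_orth_scaleR[OF orth, of t 1] by simp
  then have "alpha_dist ?x ?y / beta_dist ?x ?y \<in> ?Q"
    using t pos by (intro CollectI exI[of _ ?x] exI[of _ ?y]) auto
  then have "alpha_dist ?x ?y / beta_dist ?x ?y \<le> Sup ?Q" using bdd by (rule cSup_upper)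
  also have "\<dots> = 1" using DR by (simp add: DR_B_def)
  finally show ?thesis using pos by (simp add: divide_le_eq alpha beta)
qed

end

theorem corollary4p6:
  fixes \<gamma> :: "real \<Rightarrow> 'a::real_normed_vector"
    and r :: "real \<Rightarrow> real"
    and L :: real
  assumes "radon_plane TYPE('a)"
    and "unit_circle_arclength_param L \<gamma>"
    and "birkhoff_param L \<gamma> r"
  shows
    "(DR_B TYPE('a) = 1 \<longrightarrow>
        (\<forall>s\<in>{0..L}. \<forall>t>0.
           norm (t *\<^sub>R \<gamma> s - inverse t *\<^sub>R \<gamma> (r s)) \<ge> norm (\<gamma> s - \<gamma> (r s)))) \<and>
     (C1_on_interval L r \<and>
        (\<forall>s\<in>{0..L}. \<forall>t>0.
           norm (t *\<^sub>R \<gamma> s - inverse t *\<^sub>R \<gamma> (r s)) \<ge> norm (\<gamma> s - \<gamma> (r s))) \<longrightarrow>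
        has_constant_affine_curvature (sphere (0 :: 'a) 1) \<and> norm_from_inner_product TYPE('a))"
proof (intro conjI impI ballI allI)
  interpret radon_circle \<gamma> r L by unfold_locales (fact assms)+
  show "norm (\<gamma> s - \<gamma> (r s)) \<le> norm (t *\<^sub>R \<gamma> s - inverse t *\<^sub>R \<gamma> (r s))"
    if "DR_B TYPE('a) = 1" "s \<in> {0..L}" "0 < t" for s t
    using that by (rule alpha_le_beta)
next
  assume H: "C1_on_interval L r \<and> (\<forall>s\<in>{0..L}. \<forall>t>0.
    norm (t *\<^sub>R \<gamma> s - inverse t *\<^sub>R \<gamma> (r s)) \<ge> norm (\<gamma> s - \<gamma> (r s)))"
  then obtain \<kappa> where \<kappa>: "continuous_on {0..L} \<kappa>"
    "\<And>s. s \<in> {0..L} \<Longrightarrow> (r has_real_derivative \<kappa> s) (at s within {0..L})"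
    unfolding C1_on_interval_def by blast
  interpret radon_circle_hyperbola \<gamma> r L \<kappa>
    by unfold_locales (use assms \<kappa> H in auto)
  \<comment> \<open>The second frame vector is the velocity of \<open>\<gamma>\<close> at 0.\<close>
  interpret orthonormal_frame "\<gamma> 0" "\<epsilon> *\<^sub>R \<eta> 0"
    by unfold_locales (rule frame_span norm_frame)+
  show "has_constant_affine_curvature (sphere (0 :: 'a) 1)"
    by (rule frame_has_constant_affine_curvature)
  show "norm_from_inner_product TYPE('a)"
    by (rule frame_norm_from_inner_product)
qed

end
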